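(* Let $p>1$ and $a,b,L>0$. Then: (I) $\displaystyle \lambda^{a,b}_{1,p}(0,L)=\left(\frac{a+b}{2}\right)^p\lambda_{1,p}(0,L)$. (II) A function $u\in W^{1,p}_0(0,L)$ is an eigenfunction of $-\Delta^{a,b}_p$ associated to $\lambda^{a,b}_{1,p}(0,L)$ (i.e. a nontrivial weak solution of $-\Delta^{a,b}_p u=\lambda^{a,b}_{1,p}(0,L)|u|^{p-2}u$ in $(0,L)$, $u(0)=u(L)=0$) if and only if either $$u(t)=c\,\varphi^{a,b,+}_{p}\!\left(\tfrac{t}{L}\right)\quad\text{or}\quad u(t)=c\,\varphi^{a,b,-}_{p}\!\left(\tfrac{t}{L}\right)$$ for some constant $c>0$, where $\varphi^{a,b,\pm}_p$ are the functions defined in the context. In particular the set of eigenfunctions associated to $\lambda^{a,b}_{1,p}(0,L)$ is the union of two half-lines in $C^1[0,L]$, one generated by a function positive in $(0,L)$ and one generated by a function negative in $(0,L)$, and these two half-lines are collinear (i.e. $\varphi^{a,b,+}_p=-\varphi^{a,b,-}_p$) if and only if $a=b$.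
   Context: For $p>1$, $a,b,L>0$, the asymmetric $p$-Laplacian $\Delta^{a,b}_p u=\big(a^p[(u')^+]^{p-1}-b^p[(u')^-]^{p-1}\big)'$ is understood weakly: $u\in W^{1,p}_0(0,L)$ is a weak solution of $-\Delta^{a,b}_p u=g$ in $(0,L)$ if $\int_0^L\big(a^p[(u')^+]^{p-1}-b^p[(u')^-]^{p-1}\big)\varphi'\,dt=\int_0^L g\varphi\,dt$ for all $\varphi\in W^{1,p}_0(0,L)$. Here $s^\pm=\max\{\pm s,0\}$. $\lambda^{a,b}_{1,p}(0,L):=\inf\{\int_0^L a^p[(u')^+]^p+b^p[(u')^-]^p\,dt:\ u\in W^{1,p}_0(0,L),\ \|u\|_{L^p}=1\}$. $\pi_p:=2\int_0^1(1-t^p)^{-1/p}dt$ and $\lambda_{k,p}(0,L):=(p-1)\left(\frac{k\pi_p}{L}\right)^p$ for $k\in\mathbb N$; these are the Dirichlet eigenvalues of the classical operator $-\Delta_p u=-(|u'|^{p-2}u')'$ on $(0,L)$. $\varphi_p\in W^{1,p}_0(0,1)$ denotes the positive principal eigenfunction of $-\Delta_p$ on $(0,1)$ associated to $\lambda_{1,p}(0,1)$, normalized by $\|\varphi_p\|_{L^p}=1$. Let $t_0=\frac{a}{a+b}$. Define on $[0,1]$: $\varphi^{a,b,+}_p(t)=\varphi_p\!\left(\frac{t}{2t_0}\right)$ for $t\in[0,t_0)$, and $\varphi^{a,b,+}_p(t)=\varphi_p\!\left(\frac{t+1-2t_0}{2(1-t_0)}\right)$ for $t\in[t_0,1]$;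 $\varphi^{a,b,-}_p(t)=-\varphi_p\!\left(\frac{t}{2(1-t_0)}\right)$ for $t\in[0,1-t_0)$, and $\varphi^{a,b,-}_p(t)=-\varphi_p\!\left(\frac{t+2t_0-1}{2t_0}\right)$ for $t\in[1-t_0,1]$. *)

theory Defs
  imports "HOL-Analysis.Analysis"
begin

text \<open>One-dimensional Sobolev space W^{1,p}_0(0,L), via the continuous
representative: u is in W^{1,p}_0(0,L) with weak derivative g iff g is in
L^p(0,L), u is the primitive of g starting at u(0) = 0 on [0,L], and u(L) = 0.
Only the values of u on [0,L] are relevant.\<close>

definition W1p0_deriv :: "real \<Rightarrow> real \<Rightarrow> (real \<Rightarrow> real) \<Rightarrow> (real \<Rightarrow> real) \<Rightarrow> bool" where
  "W1p0_deriv p L u g \<longleftrightarrow>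
     g \<in> borel_measurable lborel \<and>
     set_integrable lborel {0..L} g \<and>
     set_integrable lborel {0..L} (\<lambda>t. \<bar>g t\<bar> powr p) \<and>
     (\<forall>t\<in>{0..L}. u t = (LBINT s:{0..t}. g s)) \<and>
     u L = 0"

definition W1p0 :: "real \<Rightarrow> real \<Rightarrow> (real \<Rightarrow> real) \<Rightarrow> bool" where
  "W1p0 p L u \<longleftrightarrow> (\<exists>g. W1p0_deriv p L u g)"

definition lambda_ab :: "real \<Rightarrow> real \<Rightarrow> real \<Rightarrow> real \<Rightarrow> real" where
  "lambda_ab p a b L = Inf
     {(LBINT t:{0..L}. a powr p * (max (g t) 0) powr p + b powr p * (max (- g t) 0) powr p)
       | u g. W1p0_deriv p L u g \<and> (LBINT t:{0..L}. \<bar>u t\<bar> powr p) = 1}"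

text \<open>Weak solution of  -Delta^{a,b}_p u = lam |u|^{p-2} u  in (0,L), u in W^{1,p}_0(0,L).
Here |u|^{p-2}u is written sgn(u)|u|^{p-1}.\<close>

definition weak_sol_ab :: "real \<Rightarrow> real \<Rightarrow> real \<Rightarrow> real \<Rightarrow> real \<Rightarrow> (real \<Rightarrow> real) \<Rightarrow> bool" where
  "weak_sol_ab p a b L lam u \<longleftrightarrow>
     (\<exists>g. W1p0_deriv p L u g \<and>
        (\<forall>v h. W1p0_deriv p L v h \<longrightarrow>
           (LBINT t:{0..L}. (a powr p * (max (g t) 0) powr (p - 1)
                              - b powr p * (max (- g t) 0) powr (p - 1)) * h t)
           = lam * (LBINT t:{0..L}. sgn (u t) * \<bar>u t\<bar> powr (p - 1) * v t)))"

definition eigenfunction_ab :: "real \<Rightarrow> real \<Rightarrow> real \<Rightarrow> real \<Rightarrow> real \<Rightarrow> (real \<Rightarrow> real) \<Rightarrow> bool" where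
  "eigenfunction_ab p a b L lam u \<longleftrightarrow>
     weak_sol_ab p a b L lam u \<and> (\<exists>t\<in>{0..L}. u t \<noteq> 0)"

definition weak_sol_p :: "real \<Rightarrow> real \<Rightarrow> real \<Rightarrow> (real \<Rightarrow> real) \<Rightarrow> bool" where
  "weak_sol_p p L lam u \<longleftrightarrow>
     (\<exists>g. W1p0_deriv p L u g \<and>
        (\<forall>v h. W1p0_deriv p L v h \<longrightarrow>
           (LBINT t:{0..L}. sgn (g t) * \<bar>g t\<bar> powr (p - 1) * h t)
           = lam * (LBINT t:{0..L}. sgn (u t) * \<bar>u t\<bar> powr (p - 1) * v t)))"

definition pi_p :: "real \<Rightarrow> real" where
  "pi_p p = 2 * (LBINT t:{0..1}. (1 - t powr p) powr (- 1 / p))"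

definition lambda_kp :: "nat \<Rightarrow> real \<Rightarrow> real \<Rightarrow> real" where
  "lambda_kp k p L = (p - 1) * (real k * pi_p p / L) powr p"

text \<open>Positive principal eigenfunction of -Delta_p on (0,1), L^p-normalised;
made a unique function by setting it to 0 outside [0,1].\<close>

definition phi_p :: "real \<Rightarrow> real \<Rightarrow> real" where
  "phi_p p = (THE u. weak_sol_p p 1 (lambda_kp 1 p 1) u \<and>
                     (\<forall>t\<in>{0<..<1}. u t > 0) \<and>
                     (LBINT t:{0..1}. \<bar>u t\<bar> powr p) = 1 \<and>
                     (\<forall>t. t \<notin> {0..1} \<longrightarrow> u t = 0))"

definition phi_ab_plus :: "real \<Rightarrow> real \<Rightarrow> real \<Rightarrow> real \<Rightarrow> real" where
  "phi_ab_plus p a b t =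
     (let t0 = a / (a + b) in
      if t < t0 then phi_p p (t / (2 * t0))
      else phi_p p ((t + 1 - 2 * t0) / (2 * (1 - t0))))"

definition phi_ab_minus :: "real \<Rightarrow> real \<Rightarrow> real \<Rightarrow> real \<Rightarrow> real" where
  "phi_ab_minus p a b t =
     (let t0 = a / (a + b) in
      if t < 1 - t0 then - phi_p p (t / (2 * (1 - t0)))
      else - phi_p p ((t + 2 * t0 - 1) / (2 * t0)))"

definition C1_on :: "real set \<Rightarrow> (real \<Rightarrow> real) \<Rightarrow> bool" where
  "C1_on S f \<longleftrightarrow> (\<exists>f'. continuous_on S f' \<and>
                      (\<forall>t\<in>S. (f has_real_derivative f' t) (at t within S)))"

end

theory Submission
  imports Defs
begin

text \<open>
  The quarter arch \<open>sin_p\<close>, the inverse of \<open>x \<mapsto> \<integral>\<^sub>0\<^sup>x (1 - t\<^sup>p)\<^bsup>-1/p\<^esup> dt\<close>,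
  stretched by factors proportional to \<open>a\<close> and \<open>b\<close>, gives a positive solution \<open>\<psi>\<close> whose flux
  \<open>q = a\<^sup>p (\<psi>'\<^sup>+)\<^bsup>p-1\<^esup> - b\<^sup>p (\<psi>'\<^sup>-)\<^bsup>p-1\<^esup>\<close> satisfies \<open>q' = -\<Lambda> \<psi>\<^bsup>p-1\<^esup>\<close>.
  By Picone's identity the energy density of any \<open>u\<close> on \<open>{u > 0}\<close> dominates
  \<open>(q (u\<^sup>+ / \<psi>)\<^bsup>p-1\<^esup> u\<^sup>+)' + \<Lambda> (u\<^sup>+)\<^sup>p\<close>, with equality only where \<open>(u\<^sup>+ / \<psi>)' = 0\<close>.
  Integrating, and arguing in the same way for \<open>-u\<close> with \<open>a\<close> and \<open>b\<close> exchanged, shows that \<open>\<Lambda>\<close> is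
  the minimum of the energy and that a minimiser is a positive multiple of one of the two arches.
  An eigenfunction tested against itself is a minimiser.

  Indefinite integrals of integrable functions are used in place of absolutely continuous functions.
\<close>

section \<open>Indefinite integrals\<close>

text \<open>The field \<open>q * \<psi> powr (1 - p) * v powr p\<close> in Picone's identity, with v
  the positive part of u, contains a negative power that is unbounded at both endpoints. It can
  therefore be differentiated only on compact subintervals of (0,L), and the boundary terms have to
  be shown to vanish. They do because the decay of u forced by Hoelder's inequality compensates the
  growth of that power exactly, and the remainder is the p-energy of u near the endpoint. Treating
  one sign at a time costs no regularity: for p > 1 the function max(x,0)^p is continuously
  differentiable, so an elementary chain rule suffices. It also excludes sign changes: equality
  makes the positive part of u a multiple of \<psi> on the whole interval, so if it is not zero, no
  room is left for a negative part. No Euler-Lagrange equation is derived; the arches are checked to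
  be weak solutions directly. The case a = b = 1 also provides the uniqueness on which the definite
  description \<open>phi_p\<close> rests.\<close>

definition primitive_on :: "real \<Rightarrow> real \<Rightarrow> (real \<Rightarrow> real) \<Rightarrow> (real \<Rightarrow> real) \<Rightarrow> bool" where
  "primitive_on a b u g \<longleftrightarrow> g absolutely_integrable_on {a..b} \<and>
     (\<forall>s t. a \<le> s \<longrightarrow> s \<le> t \<longrightarrow> t \<le> b \<longrightarrow> (g has_integral u t - u s) {s..t})"

lemma primitive_on_has_integral:
  "primitive_on a b u g \<Longrightarrow> a \<le> s \<Longrightarrow> s \<le> t \<Longrightarrow> t \<le> b \<Longrightarrow> (g has_integral u t - u s) {s..t}"
  by (auto simp: primitive_on_def)

lemma primitive_on_absolutely_integrable:
  "primitive_on a b u g \<Longrightarrow> a \<le> s \<Longrightarrow> t \<le> b \<Longrightarrow> g absolutely_integrable_on {s..t}"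
  unfolding primitive_on_def using absolutely_integrable_on_subinterval by fastforce

lemma primitive_on_subinterval:
  assumes "primitive_on a b u g" "a \<le> s" "t \<le> b"
  shows "primitive_on s t u g"
  using assms primitive_on_absolutely_integrable[OF assms] by (auto simp: primitive_on_def)

lemma primitive_on_continuous:
  assumes "primitive_on a b u g"
  shows "continuous_on {a..b} u"
proof -
  have "g integrable_on {a..b}"
    using assms by (auto simp: primitive_on_def set_lebesgue_integral_eq_integral)
  then have "continuous_on {a..b} (\<lambda>t. u a + integral {a..t} g)"
    by (intro continuous_intros indefinite_integral_continuous_1)
  moreover have "u t = u a + integral {a..t} g" if "t \<in> {a..b}" for t
    using integral_unique[OF primitive_on_has_integral[OF assms, of a t]] that by auto
  ultimately show ?thesis
    by (metis (no_types, lifting) continuous_on_cong)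
qed

lemma primitive_on_integral:
  assumes "g absolutely_integrable_on {a..b}"
  shows "primitive_on a b (\<lambda>t. integral {a..t} g) g"
  unfolding primitive_on_def
proof (intro conjI allI impI)
  fix s t assume st: "a \<le> s" "s \<le> t" "t \<le> b"
  have i: "g integrable_on {a..b}"
    using assms set_lebesgue_integral_eq_integral(1) by blast
  have i1: "g integrable_on {a..t}" and i2: "g integrable_on {s..t}"
    using integrable_on_subinterval[OF i, of a t] integrable_on_subinterval[OF i, of s t] st
    by auto
  have "integral {a..s} g + integral {s..t} g = integral {a..t} g"
    using Henstock_Kurzweil_Integration.integral_combine[of a s t g] st i1 by auto
  then show "(g has_integral integral {a..t} g - integral {a..s} g) {s..t}"
    using i2 by (metis add_diff_cancel_left' integrable_integral)
qed (use assms in auto)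

lemma primitive_on_cong:
  assumes "primitive_on a b u g"
    and "\<And>t. t \<in> {a..b} \<Longrightarrow> u t = v t" "\<And>t. t \<in> {a..b} \<Longrightarrow> g t = h t"
  shows "primitive_on a b v h"
proof -
  have "h absolutely_integrable_on {a..b}"
    by (rule absolutely_integrable_spike[where f = g and S = "{}"])
      (use assms(1) in \<open>simp add: primitive_on_def\<close>, simp, simp add: assms(3))
  moreover have "(h has_integral v t - v s) {s..t}" if st: "a \<le> s" "s \<le> t" "t \<le> b" for s t
  proof -
    have "u t - u s = v t - v s" using st by (simp add: assms(2))
    moreover have "(h has_integral u t - u s) {s..t}"
      by (rule has_integral_eq[OF _ primitive_on_has_integral[OF assms(1) st]])
        (use st in \<open>simp add: assms(3)\<close>)
    ultimately show ?thesis by metis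
  qed
  ultimately show ?thesis by (auto simp: primitive_on_def)
qed

lemma primitive_on_add:
  assumes "primitive_on a b u g" "primitive_on a b v h"
  shows "primitive_on a b (\<lambda>t. u t + v t) (\<lambda>t. g t + h t)"
  unfolding primitive_on_def
proof (intro conjI allI impI)
  fix s t assume st: "a \<le> s" "s \<le> t" "t \<le> b"
  have "((\<lambda>t. g t + h t) has_integral (u t - u s) + (v t - v s)) {s..t}"
    by (intro has_integral_add primitive_on_has_integral[OF assms(1)]
        primitive_on_has_integral[OF assms(2)] st)
  then show "((\<lambda>t. g t + h t) has_integral u t + v t - (u s + v s)) {s..t}"
    by (simp add: algebra_simps)
qed (use assms in \<open>auto simp: primitive_on_def\<close>)

lemma primitive_on_cmult:
  assumes "primitive_on a b u g"
  shows "primitive_on a b (\<lambda>t. c * u t) (\<lambda>t. c * g t)"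
  unfolding primitive_on_def
proof (intro conjI allI impI)
  fix s t assume st: "a \<le> s" "s \<le> t" "t \<le> b"
  have "((\<lambda>t. c * g t) has_integral c * (u t - u s)) {s..t}"
    by (intro has_integral_mult_right primitive_on_has_integral[OF assms] st)
  then show "((\<lambda>t. c * g t) has_integral c * u t - c * u s) {s..t}"
    by (simp add: algebra_simps)
qed (use assms in \<open>auto simp: primitive_on_def\<close>)

lemma primitive_on_diff:
  assumes "primitive_on a b u g" "primitive_on a b v h"
  shows "primitive_on a b (\<lambda>t. u t - v t) (\<lambda>t. g t - h t)"
  using primitive_on_add[OF assms(1) primitive_on_cmult[OF assms(2), of "-1"]] by simp

text \<open>The finite set \<open>K\<close> makes room for the point where the two halves of the
  arch meet, at which neither formula alone gives a two-sided derivative.\<close>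

lemma primitive_on_C1:
  assumes "finite K" "continuous_on {a..b} u" "continuous_on {a..b} g"
    and "\<And>t. t \<in> {a<..<b} - K \<Longrightarrow> (u has_real_derivative g t) (at t)"
  shows "primitive_on a b u g"
  unfolding primitive_on_def
proof (intro conjI allI impI)
  show "g absolutely_integrable_on {a..b}"
    using assms(3) absolutely_integrable_continuous_real by blast
  fix s t assume st: "a \<le> s" "s \<le> t" "t \<le> b"
  show "(g has_integral u t - u s) {s..t}"
    using assms st continuous_on_subset[OF assms(2), of "{s..t}"]
    by (intro fundamental_theorem_of_calculus_interior_strong[of K])
      (auto simp flip: has_real_derivative_iff_has_vector_derivative)
qed

text \<open>Applied to a primitive obtained from \<open>primitive_on_C1\<close>, this recovers the
  derivative at the exceptional points too, because the integrand is continuous there.\<close>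

lemma primitive_on_has_real_derivative:
  assumes "primitive_on a b u g" "continuous_on {a..b} g" "t \<in> {a..b}"
  shows "(u has_real_derivative g t) (at t within {a..b})"
proof -
  have "((\<lambda>x. u a + integral {a..x} g) has_real_derivative g t) (at t within {a..b})"
    using integral_has_real_derivative[OF assms(2,3)] by (auto intro!: derivative_eq_intros)
  moreover have "u x = u a + integral {a..x} g" if "x \<in> {a..b}" for x
    using integral_unique[OF primitive_on_has_integral[OF assms(1), of a x]] that by auto
  ultimately show ?thesis
    using has_field_derivative_transform_within[of _ "g t" t "{a..b}" 1 u] assms(3)
    by (metis (no_types, lifting) zero_less_one)
qed

lemma absolutely_integrable_continuous_mult:
  fixes f g :: "real \<Rightarrow> real"
  assumes "continuous_on {a..b} f" "g absolutely_integrable_on {a..b}"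
  shows "(\<lambda>t. f t * g t) absolutely_integrable_on {a..b}"
proof (rule absolutely_integrable_bounded_measurable_product_real)
  show "f \<in> borel_measurable (lebesgue_on {a..b})"
    using assms by (intro continuous_imp_measurable_on_sets_lebesgue) auto
  show "bounded (f ` {a..b})"
    using assms(1) compact_continuous_image compact_imp_bounded compact_Icc by blast
qed (use assms in auto)

text \<open>Both sides of the claim are additive over intervals, so a bound of their difference by a
  small multiple of \<open>\<integral>\<bar>g\<bar>\<close> on short intervals, which is the mean value theorem for \<open>F\<close>,
  propagates to the whole interval.\<close>
lemma primitive_on_chain:
  assumes u: "primitive_on a b u g"
    and F: "\<And>x. (F has_real_derivative F' x) (at x)"
    and F': "continuous_on UNIV F'"
  shows "primitive_on a b (\<lambda>t. F (u t)) (\<lambda>t. F' (u t) * g t)"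
proof -
  let ?h = "\<lambda>t. F' (u t) * g t"
  have cu: "continuous_on {a..b} u" by (rule primitive_on_continuous[OF u])
  have cFu: "continuous_on {a..b} (\<lambda>t. F' (u t))"
    using continuous_on_compose2[OF F' cu] by auto
  have ga: "g absolutely_integrable_on {a..b}" using u by (simp add: primitive_on_def)
  have habs: "?h absolutely_integrable_on {a..b}"
    by (rule absolutely_integrable_continuous_mult[OF cFu ga])
  define I where "I t = integral {a..t} ?h" for t
  define M where "M t = integral {a..t} (\<lambda>x. \<bar>g x\<bar>)" for t
  have I: "primitive_on a b I ?h" unfolding I_def by (rule primitive_on_integral[OF habs])
  have gabs: "(\<lambda>x. \<bar>g x\<bar>) absolutely_integrable_on {a..b}"
    using ga set_integrable_abs by blast
  have M: "primitive_on a b M (\<lambda>x. \<bar>g x\<bar>)"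
    unfolding M_def by (rule primitive_on_integral[OF gabs])
  have key: "\<bar>F (u t) - F (u s) - (I t - I s)\<bar> \<le> e * (M t - M s)"
    if st: "a \<le> s" "s \<le> t" "t \<le> b" and e: "e > 0" for s t e
  proof -
    define P where "P x y \<longleftrightarrow> (s \<le> x \<longrightarrow> x \<le> y \<longrightarrow> y \<le> t \<longrightarrow>
        \<bar>F (u y) - F (u x) - (I y - I x)\<bar> \<le> e * (M y - M x))" for x y
    have "P s t"
      using \<open>s \<le> t\<close>
    proof (induction rule: Bolzano)
      case (trans x y z)
      then show ?case unfolding P_def
        by (fastforce simp: algebra_simps abs_le_iff)
    next
      case (local x)
      have xab: "x \<in> {a..b}" using local st by auto
      \<comment> \<open>Half of \<open>e\<close>, because \<open>F' \<xi>\<close> and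
        \<open>F' (u \<tau>)\<close> will both be compared with \<open>F' (u x)\<close>.\<close>
      obtain \<eta> where eta: "\<eta> > 0" "\<And>y. \<bar>y - u x\<bar> < \<eta> \<Longrightarrow> \<bar>F' y - F' (u x)\<bar> < e/2"
        using F' e unfolding continuous_on_iff dist_real_def
        by (metis UNIV_I half_gt_zero)
      obtain d where d: "d > 0" "\<And>y. y \<in> {a..b} \<Longrightarrow> \<bar>y - x\<bar> < d \<Longrightarrow> \<bar>u y - u x\<bar> < \<eta>"
        using cu xab eta(1) unfolding continuous_on_iff dist_real_def by metis
      have "P y z" if yz: "y \<le> x" "x \<le> z" "z - y < d" for y z
        unfolding P_def
      proof (intro impI)
        assume "s \<le> y" "y \<le> z" "z \<le> t"
        then have yzab: "a \<le> y" "y \<le> z" "z \<le> b" using st by auto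
        have uclose: "\<bar>u \<tau> - u x\<bar> < \<eta>" if "\<tau> \<in> {y..z}" for \<tau>
          using d(2)[of \<tau>] that yzab yz by auto
        obtain \<xi> where xi: "F (u z) - F (u y) = F' \<xi> * (u z - u y)" "\<bar>\<xi> - u x\<bar> < \<eta>"
        proof -
          consider "u y < u z" | "u z < u y" | "u y = u z" by linarith
          then show ?thesis
          proof cases
            case 1
            obtain w where "u y < w" "w < u z" "F (u z) - F (u y) = (u z - u y) * F' w"
              using MVT2[OF 1, of F F'] F by auto
            then show ?thesis using that[of w] uclose[of y] uclose[of z] yzab
              by (auto simp: mult.commute abs_less_iff)
          next
            case 2
            obtain w where "u z < w" "w < u y" "F (u y) - F (u z) = (u y - u z) * F' w"
              using MVT2[OF 2, of F F'] F by auto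
            then show ?thesis using that[of w] uclose[of y] uclose[of z] yzab
              by (auto simp: algebra_simps abs_less_iff)
          next
            case 3
            then show ?thesis using that[of "u x"] eta by auto
          qed
        qed
        \<comment> \<open>With \<open>\<xi>\<close> frozen, the error of the increment is the
          integral of \<open>(F' \<xi> - F' (u \<tau>)) * g \<tau>\<close>, which is bounded
          pointwise by \<open>e * \<bar>g \<tau>\<bar>\<close>.\<close>
        have "((\<lambda>\<tau>. F' \<xi> * g \<tau> - ?h \<tau>) has_integral (F' \<xi> * (u z - u y) - (I z - I y))) {y..z}"
          by (intro has_integral_diff has_integral_mult_right primitive_on_has_integral[OF u]
              primitive_on_has_integral[OF I] yzab)
        moreover have "((\<lambda>\<tau>. e * \<bar>g \<tau>\<bar>) has_integral e * (M z - M y)) {y..z}"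
          by (intro has_integral_mult_right primitive_on_has_integral[OF M] yzab)
        moreover have "norm (F' \<xi> * g \<tau> - ?h \<tau>) \<le> e * \<bar>g \<tau>\<bar>" if "\<tau> \<in> {y..z}" for \<tau>
        proof -
          have "\<bar>F' \<xi> - F' (u \<tau>)\<bar> \<le> e"
            using eta(2)[OF xi(2)] eta(2)[OF uclose[OF that]] by linarith
          then have "\<bar>F' \<xi> - F' (u \<tau>)\<bar> * \<bar>g \<tau>\<bar> \<le> e * \<bar>g \<tau>\<bar>"
            by (intro mult_right_mono) auto
          then show ?thesis by (simp add: abs_mult[symmetric] algebra_simps)
        qed
        ultimately have "norm (F' \<xi> * (u z - u y) - (I z - I y)) \<le> e * (M z - M y)"
          by (metis (no_types, lifting) integral_norm_bound_integral has_integral_iff)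
        then show "\<bar>F (u z) - F (u y) - (I z - I y)\<bar> \<le> e * (M z - M y)"
          using xi by simp
      qed
      then show ?case using \<open>d > 0\<close> by blast
    qed
    then show ?thesis using st by (simp add: P_def)
  qed
  have eq: "F (u t) - F (u s) = I t - I s" if st: "a \<le> s" "s \<le> t" "t \<le> b" for s t
  proof -
    have "M t - M s \<ge> 0"
      using has_integral_nonneg[OF primitive_on_has_integral[OF M st]] by auto
    have small: "\<bar>F (u t) - F (u s) - (I t - I s)\<bar> \<le> 0 + e" if "e > 0" for e
    proof -
      \<comment> \<open>The summand 1 keeps the divisor positive when
        \<open>M t = M s\<close>.\<close>
      have "\<bar>F (u t) - F (u s) - (I t - I s)\<bar> \<le> e / (1 + (M t - M s)) * (M t - M s)"
        using \<open>M t - M s \<ge> 0\<close> that by (intro key st) auto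
      also have "\<dots> \<le> e"
        using \<open>M t - M s \<ge> 0\<close> that by (simp add: field_simps)
      finally show ?thesis by simp
    qed
    have "\<bar>F (u t) - F (u s) - (I t - I s)\<bar> \<le> 0"
      by (rule field_le_epsilon[OF small])
    then show ?thesis by simp
  qed
  show ?thesis
    unfolding primitive_on_def
  proof (intro conjI allI impI habs)
    fix s t assume st: "a \<le> s" "s \<le> t" "t \<le> b"
    show "(?h has_integral F (u t) - F (u s)) {s..t}"
      unfolding eq[OF st] by (rule primitive_on_has_integral[OF I st])
  qed
qed

text \<open>Polarisation, u v = ((u + v)^2 - u^2 - v^2) / 2, reduces the product rule to the chain
  rule for the square.\<close>

lemma primitive_on_mult:
  assumes u: "primitive_on a b u g" and v: "primitive_on a b v h"
  shows "primitive_on a b (\<lambda>t. u t * v t) (\<lambda>t. g t * v t + u t * h t)"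
proof -
  have sq: "primitive_on a b (\<lambda>t. (w t)\<^sup>2) (\<lambda>t. 2 * w t * k t)" if "primitive_on a b w k" for w k
    by (rule primitive_on_chain[OF that, where F' = "\<lambda>x. 2 * x"])
      (auto intro!: derivative_eq_intros continuous_intros)
  have "primitive_on a b (\<lambda>t. 1/2 * (((u t + v t)\<^sup>2 - (u t)\<^sup>2) - (v t)\<^sup>2))
      (\<lambda>t. 1/2 * ((2 * (u t + v t) * (g t + h t) - 2 * u t * g t) - 2 * v t * h t))"
    by (intro primitive_on_cmult primitive_on_diff sq primitive_on_add u v)
  then show ?thesis
    by (rule primitive_on_cong) (auto simp: power2_eq_square algebra_simps)
qed

section \<open>The generalised sine\<close>

text \<open>The statement integrates with respect to \<open>lborel\<close>, whereas absolute
  integrability refers to its completion \<open>lebesgue\<close>; for Borel integrands this makes no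
  difference.\<close>

lemma set_integrable_lborel_iff_absolutely_integrable:
  fixes f :: "real \<Rightarrow> real"
  assumes "f \<in> borel_measurable borel" "A \<in> sets borel"
  shows "set_integrable lborel A f \<longleftrightarrow> f absolutely_integrable_on A"
  unfolding set_integrable_def
  by (rule integrable_completion[symmetric]) (use assms in measurable)

definition arcsin_p :: "real \<Rightarrow> real \<Rightarrow> real" where
  "arcsin_p p x = integral {0..x} (\<lambda>t. (1 - t powr p) powr (-1 / p))"

definition sin_p :: "real \<Rightarrow> real \<Rightarrow> real" where
  "sin_p p = inv_into {0..1} (arcsin_p p)"

text \<open>This is the derivative of \<open>sin_p\<close> inside the quarter period, in the form
  that the inverse function rule gives. There \<open>sin_p\<close> and \<open>cos_p\<close> satisfy
  x^p + y^p = 1 by construction.\<close>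

definition cos_p :: "real \<Rightarrow> real \<Rightarrow> real" where
  "cos_p p t = (1 - sin_p p t powr p) powr (1 / p)"

context
  fixes p :: real
  assumes p: "p > 1"
begin

lemma one_minus_powr_pos: "0 \<le> t \<Longrightarrow> t < 1 \<Longrightarrow> 0 < 1 - t powr p"
  using powr_less_mono2[of p t 1] p by auto

text \<open>The only singularity is at 1. Since t^p <= t, the function (1 - t)^(-1/p) is a majorant,
  and it is integrable because 1/p < 1.\<close>

lemma arcsin_p_integrand_absolutely_integrable:
  "(\<lambda>t. (1 - t powr p) powr (-1 / p)) absolutely_integrable_on {0..1}"
proof (rule measurable_bounded_by_integrable_imp_absolutely_integrable)
  let ?F = "\<lambda>t. - ((1 - t) powr (1 - 1/p) / (1 - 1/p))"
  have "((\<lambda>t. (1 - t) powr (-1/p)) has_integral ?F 1 - ?F 0) {0..1}"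
  proof (rule fundamental_theorem_of_calculus_interior)
    show "continuous_on {0..1} ?F"
      using p by (intro continuous_intros continuous_on_powr') auto
    show "(?F has_vector_derivative (1 - t) powr (-1/p)) (at t)" if "t \<in> {0<..<1}" for t
    proof -
      define e where "e = 1 - 1/p"
      have e: "e \<noteq> 0" "-1/p = e - 1" using p by (auto simp: e_def)
      have "((\<lambda>t. - ((1 - t) powr e / e)) has_real_derivative (1 - t) powr (e - 1)) (at t)"
        using that e by (auto intro!: derivative_eq_intros)
      then show ?thesis
        unfolding e(2) e_def[symmetric] has_real_derivative_iff_has_vector_derivative .
    qed
  qed auto
  then show "(\<lambda>t. (1 - t) powr (-1/p)) integrable_on {0..1}"
    by blast
  show "norm ((1 - t powr p) powr (-1/p)) \<le> (1 - t) powr (-1/p)" if "t \<in> {0..1}" for t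
  proof (cases "t = 1")
    case False
    have "t powr p \<le> t powr 1"
      using that p by (intro powr_mono') auto
    then show ?thesis using that p False by (auto intro!: powr_mono2')
  qed auto
  show "(\<lambda>t. (1 - t powr p) powr (-1/p)) \<in> borel_measurable (lebesgue_on {0..1})"
    by (intro borel_measurable_if_D measurable_completion measurable_restrict_space1) measurable
qed auto

lemma primitive_on_arcsin_p:
  "primitive_on 0 1 (arcsin_p p) (\<lambda>t. (1 - t powr p) powr (-1 / p))"
  using primitive_on_integral[OF arcsin_p_integrand_absolutely_integrable]
  by (simp add: arcsin_p_def[abs_def])

lemma pi_p_eq: "pi_p p = 2 * arcsin_p p 1"
proof -
  have "set_integrable lborel {0..1} (\<lambda>t. (1 - t powr p) powr (-1 / p))"
    using arcsin_p_integrand_absolutely_integrable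
    by (subst set_integrable_lborel_iff_absolutely_integrable) auto
  then show ?thesis
    by (simp add: pi_p_def arcsin_p_def set_borel_integral_eq_integral)
qed

lemma arcsin_p_0 [simp]: "arcsin_p p 0 = 0"
  by (simp add: arcsin_p_def)

text \<open>The integrand is at least 1 away from the point 1. This one estimate yields the
  positivity of \<open>pi_p\<close> and the strict monotonicity of \<open>arcsin_p\<close>.\<close>

lemma arcsin_p_expanding:
  assumes "0 \<le> x" "x \<le> y" "y \<le> 1"
  shows "y - x \<le> arcsin_p p y - arcsin_p p x"
proof -
  have 1: "((\<lambda>t. (1 - t powr p) powr (-1 / p)) has_integral arcsin_p p y - arcsin_p p x) {x..y}"
    by (rule primitive_on_has_integral[OF primitive_on_arcsin_p assms])
  \<comment> \<open>At \<open>t = 1\<close> the integrand is \<open>0 powr (-1 / p)\<close>, which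
    is 0, so the lower bound 1 fails there; the integrand is redefined at that point.\<close>
  have 2: "((\<lambda>t. if t = 1 then 1 else (1 - t powr p) powr (-1 / p))
      has_integral arcsin_p p y - arcsin_p p x) {x..y}"
    by (rule has_integral_spike[OF _ _ 1, of "{1}"]) auto
  have 3: "((\<lambda>t. 1) has_integral y - x) {x..y}"
    using has_integral_const_real[of "1::real" x y] assms by simp
  have "1 \<le> (if t = 1 then 1 else (1 - t powr p) powr (-1 / p))" if "t \<in> {x..y}" for t
  proof (cases "t = 1")
    case False
    then have "t \<ge> 0" "t < 1" using that assms by auto
    then have "1 powr (-1/p) \<le> (1 - t powr p) powr (-1 / p)"
      using p one_minus_powr_pos[of t] by (intro powr_mono2') auto
    then show ?thesis using False by simp
  qed auto
  then show ?thesis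
    by (rule has_integral_le[OF 3 2])
qed

lemma pi_p_pos: "pi_p p > 0"
  using arcsin_p_expanding[of 0 1] by (simp add: pi_p_eq)

lemma continuous_on_arcsin_p: "continuous_on {0..1} (arcsin_p p)"
  by (rule primitive_on_continuous[OF primitive_on_arcsin_p])

lemma arcsin_p_strict_mono:
  "0 \<le> x \<Longrightarrow> x < y \<Longrightarrow> y \<le> 1 \<Longrightarrow> arcsin_p p x < arcsin_p p y"
  using arcsin_p_expanding[of x y] by simp

lemma inj_on_arcsin_p: "inj_on (arcsin_p p) {0..1}"
  by (rule linorder_inj_onI) (use arcsin_p_strict_mono in \<open>force+\<close>)

lemma arcsin_p_image: "arcsin_p p ` {0..1} = {0..pi_p p / 2}"
proof (intro equalityI subsetI)
  fix y assume "y \<in> arcsin_p p ` {0..1}"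
  then show "y \<in> {0..pi_p p / 2}"
    using arcsin_p_expanding[of 0] arcsin_p_expanding[of _ 1] by (force simp: pi_p_eq)
next
  fix y assume "y \<in> {0..pi_p p / 2}"
  then show "y \<in> arcsin_p p ` {0..1}"
    using IVT'[of "arcsin_p p" 0 y 1] continuous_on_arcsin_p by (auto simp: pi_p_eq)
qed

lemma arcsin_p_sin_p: "t \<in> {0..pi_p p / 2} \<Longrightarrow> arcsin_p p (sin_p p t) = t"
  unfolding sin_p_def by (rule f_inv_into_f) (simp add: arcsin_p_image)

lemma sin_p_arcsin_p: "x \<in> {0..1} \<Longrightarrow> sin_p p (arcsin_p p x) = x"
  unfolding sin_p_def by (rule inv_into_f_f[OF inj_on_arcsin_p])

lemma sin_p_range: "t \<in> {0..pi_p p / 2} \<Longrightarrow> sin_p p t \<in> {0..1}"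
  unfolding sin_p_def by (rule inv_into_into) (simp add: arcsin_p_image)

lemma sin_p_0 [simp]: "sin_p p 0 = 0"
  using sin_p_arcsin_p[of 0] by simp

lemma sin_p_half_pi_p [simp]: "sin_p p (pi_p p / 2) = 1"
  using sin_p_arcsin_p[of 1] by (simp add: pi_p_eq)

lemma continuous_on_sin_p: "continuous_on {0..pi_p p / 2} (sin_p p)"
  using continuous_on_inv[OF continuous_on_arcsin_p, of "sin_p p"] sin_p_arcsin_p
  by (simp add: arcsin_p_image)

lemma sin_p_eq_1_iff: "t \<in> {0..pi_p p / 2} \<Longrightarrow> sin_p p t = 1 \<longleftrightarrow> t = pi_p p / 2"
  using arcsin_p_sin_p[of t] by (auto simp: pi_p_eq sin_p_arcsin_p)

lemma sin_p_eq_0_iff: "t \<in> {0..pi_p p / 2} \<Longrightarrow> sin_p p t = 0 \<longleftrightarrow> t = 0"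
  using arcsin_p_sin_p[of t] by auto

lemma sin_p_pos: "0 < t \<Longrightarrow> t \<le> pi_p p / 2 \<Longrightarrow> 0 < sin_p p t"
  using sin_p_range[of t] sin_p_eq_0_iff[of t] by force

lemma sin_p_less_1: "0 \<le> t \<Longrightarrow> t < pi_p p / 2 \<Longrightarrow> sin_p p t < 1"
  using sin_p_range[of t] sin_p_eq_1_iff[of t] by force

lemma continuous_on_cos_p: "continuous_on {0..pi_p p / 2} (cos_p p)"
  unfolding cos_p_def
  using p sin_p_range
  by (intro continuous_on_powr' continuous_intros continuous_on_sin_p)
    (force simp: powr_le1)+

lemma cos_p_nonneg: "0 \<le> cos_p p t"
  by (simp add: cos_p_def)

lemma cos_p_half_pi_p [simp]: "cos_p p (pi_p p / 2) = 0"
  by (simp add: cos_p_def)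

lemma continuous_on_arcsin_p_integrand:
  assumes "c < 1"
  shows "continuous_on {0..c} (\<lambda>t. (1 - t powr p) powr (-1 / p))"
proof -
  have "continuous_on {0..c} (\<lambda>t. t powr p)"
    using p by (intro continuous_on_powr' continuous_intros) auto
  then have "continuous_on {0..c} (\<lambda>t. 1 - t powr p)"
    by (intro continuous_on_diff continuous_on_const)
  moreover have "\<forall>t\<in>{0..c}. 1 - t powr p \<noteq> 0"
    using one_minus_powr_pos assms by force
  ultimately show ?thesis
    by (intro continuous_on_powr continuous_on_const)
qed

lemma arcsin_p_has_real_derivative:
  assumes "0 < x" "x < 1"
  shows "(arcsin_p p has_real_derivative (1 - x powr p) powr (-1 / p)) (at x)"
proof -
  \<comment> \<open>The integrand is unbounded near 1; stopping at some \<open>c < 1\<close> leaves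
    a continuous one.\<close>
  obtain c where c: "x < c" "c < 1" using assms dense by blast
  have "primitive_on 0 c (arcsin_p p) (\<lambda>t. (1 - t powr p) powr (-1 / p))"
    using primitive_on_subinterval[OF primitive_on_arcsin_p] c by simp
  then have "(arcsin_p p has_real_derivative (1 - x powr p) powr (-1 / p)) (at x within {0..c})"
    using c assms
    by (intro primitive_on_has_real_derivative continuous_on_arcsin_p_integrand) auto
  then show ?thesis using c assms by (simp add: at_within_Icc_at)
qed

lemma sin_p_has_real_derivative:
  assumes "0 < t" "t < pi_p p / 2"
  shows "(sin_p p has_real_derivative cos_p p t) (at t)"
proof -
  have s: "0 < sin_p p t" "sin_p p t < 1"
    using sin_p_pos[of t] sin_p_less_1[of t] assms by auto
  have pos: "0 < 1 - sin_p p t powr p" using s one_minus_powr_pos by simp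
  have "(sin_p p has_real_derivative inverse ((1 - sin_p p t powr p) powr (-1 / p))) (at t)"
  proof (rule DERIV_inverse_function[where a = 0 and b = "pi_p p / 2"])
    show "isCont (sin_p p) t"
      using continuous_on_interior[OF continuous_on_sin_p] assms by simp
  qed (use assms pos s arcsin_p_has_real_derivative arcsin_p_sin_p in auto)
  moreover have "inverse ((1 - sin_p p t powr p) powr (-1 / p)) = cos_p p t"
    by (simp add: cos_p_def powr_minus)
  ultimately show ?thesis by simp
qed

text \<open>The p-Laplace equation of \<open>sin_p\<close>: minus the derivative of (sin_p')^(p-1)
  is (p-1) sin_p^(p-1). It is the source of the factor \<open>p - 1\<close> in the
  eigenvalue.\<close>

lemma cos_p_powr_has_real_derivative:
  assumes "0 < t" "t < pi_p p / 2"
  shows "((\<lambda>x. cos_p p x powr (p - 1)) has_real_derivative - (p - 1) * sin_p p t powr (p - 1)) (at t)"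
proof -
  have s: "0 < sin_p p t" "sin_p p t < 1"
    using sin_p_pos[of t] sin_p_less_1[of t] assms by auto
  have pos: "0 < 1 - sin_p p t powr p" using s one_minus_powr_pos by simp
  have eq: "cos_p p x powr (p - 1) = (1 - sin_p p x powr p) powr ((p - 1) / p)" for x
    by (simp add: cos_p_def powr_powr)
  have 1: "((\<lambda>x. (1 - sin_p p x powr p) powr ((p - 1) / p)) has_real_derivative
      (p - 1) / p * (1 - sin_p p t powr p) powr ((p - 1) / p - 1) * (- (p * sin_p p t powr (p - 1) * cos_p p t))) (at t)"
    by (rule derivative_eq_intros sin_p_has_real_derivative assms s pos refl | simp)+
  \<comment> \<open>The exponents cancel: (p - 1)/p - 1 = -1/p, and \<open>cos_p\<close> is the
    power 1/p of the same base.\<close>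
  have "(1 - sin_p p t powr p) powr ((p - 1) / p - 1) * cos_p p t = 1"
    using pos p by (simp add: cos_p_def powr_add[symmetric] field_simps)
  moreover have "(p - 1) / p * x * (- (p * y * z)) = - (p - 1) * y * (x * z)" for x y z :: real
    using p by (simp add: field_simps)
  ultimately have "(p - 1) / p * (1 - sin_p p t powr p) powr ((p - 1) / p - 1) *
      (- (p * sin_p p t powr (p - 1) * cos_p p t)) = - (p - 1) * sin_p p t powr (p - 1)"
    by (metis mult.right_neutral)
  with 1 show ?thesis unfolding eq by simp
qed

text \<open>For x <= 1/2 the integrand of \<open>arcsin_p\<close> is at most its value at 1/2; for x
  >= 1/2 the value of \<open>arcsin_p\<close> is at most pi_p / 2 <= pi_p x. The sum of the two
  constants serves both cases. The bound controls negative powers of the arch near the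
  endpoints.\<close>

lemma sin_p_linear_lower_bound:
  obtains K where "K > 0" "\<And>t. t \<in> {0..pi_p p / 2} \<Longrightarrow> t \<le> K * sin_p p t"
proof -
  define f where "f = (\<lambda>t::real. (1 - t powr p) powr (-1 / p))"
  have fpos: "f (1/2) > 0" using one_minus_powr_pos[of "1/2"] by (auto simp: f_def)
  have A: "arcsin_p p x \<le> (f (1/2) + pi_p p) * x" if x: "x \<in> {0..1}" for x
  proof (cases "x \<le> 1/2")
    case True
    have "arcsin_p p x - arcsin_p p 0 \<le> f (1/2) * (x - 0)"
    proof (rule has_integral_le)
      show "(f has_integral arcsin_p p x - arcsin_p p 0) {0..x}"
        unfolding f_def using x by (intro primitive_on_has_integral[OF primitive_on_arcsin_p]) auto
      show "((\<lambda>t. f (1/2)) has_integral f (1/2) * (x - 0)) {0..x}"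
        using has_integral_const_real[of "f (1/2)" 0 x] x by (simp add: mult.commute)
      show "f t \<le> f (1/2)" if "t \<in> {0..x}" for t
        unfolding f_def using that True p one_minus_powr_pos[of "1/2"] powr_mono2[of p t "1/2"]
        by (intro powr_mono2') auto
    qed
    moreover have "0 \<le> pi_p p * x" using pi_p_pos x by simp
    ultimately show ?thesis by (simp add: algebra_simps)
  next
    case False
    have "arcsin_p p x \<le> arcsin_p p 1" using arcsin_p_expanding[of x 1] x by simp
    also have "\<dots> = pi_p p * (1/2)" by (simp add: pi_p_eq)
    also have "\<dots> \<le> pi_p p * x" using False pi_p_pos by (intro mult_left_mono) auto
    also have "\<dots> \<le> (f (1/2) + pi_p p) * x" using fpos x by (simp add: algebra_simps)
    finally show ?thesis .
  qed
  show ?thesis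
  proof (rule that)
    show "f (1/2) + pi_p p > 0" using fpos pi_p_pos by simp
    show "t \<le> (f (1/2) + pi_p p) * sin_p p t" if "t \<in> {0..pi_p p / 2}" for t
      using A[OF sin_p_range[OF that]] by (simp add: arcsin_p_sin_p[OF that])
  qed
qed

end

section \<open>The asymmetric arch\<close>

definition ab_energy :: "real \<Rightarrow> real \<Rightarrow> real \<Rightarrow> real \<Rightarrow> real" where
  "ab_energy p a b x = a powr p * max x 0 powr p + b powr p * max (- x) 0 powr p"

definition ab_flux :: "real \<Rightarrow> real \<Rightarrow> real \<Rightarrow> real \<Rightarrow> real" where
  "ab_flux p a b x = a powr p * max x 0 powr (p - 1) - b powr p * max (- x) 0 powr (p - 1)"

text \<open>The common speed w of both halves. With angles w t / a and w (L - t) / b they complete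
  their quarter periods \<open>pi_p p / 2\<close> over lengths a pi_p / (2 w) and b pi_p / (2 w),
  and these add up to L for exactly this w.\<close>

definition ab_freq :: "real \<Rightarrow> real \<Rightarrow> real \<Rightarrow> real \<Rightarrow> real" where
  "ab_freq p a b L = (a + b) * pi_p p / (2 * L)"

definition ab_arch :: "real \<Rightarrow> real \<Rightarrow> real \<Rightarrow> real \<Rightarrow> real \<Rightarrow> real" where
  "ab_arch p a b L t = (if t \<le> a * L / (a + b) then sin_p p (ab_freq p a b L * t / a)
     else sin_p p (ab_freq p a b L * (L - t) / b))"

definition ab_arch_deriv :: "real \<Rightarrow> real \<Rightarrow> real \<Rightarrow> real \<Rightarrow> real \<Rightarrow> real" where
  "ab_arch_deriv p a b L t = (if t \<le> a * L / (a + b)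
     then ab_freq p a b L / a * cos_p p (ab_freq p a b L * t / a)
     else - (ab_freq p a b L / b) * cos_p p (ab_freq p a b L * (L - t) / b))"

definition ab_eigenvalue :: "real \<Rightarrow> real \<Rightarrow> real \<Rightarrow> real \<Rightarrow> real" where
  "ab_eigenvalue p a b L = (p - 1) * ab_freq p a b L powr p"

context
  fixes p a b L :: real
  assumes p: "p > 1" and a: "a > 0" and b: "b > 0" and L: "L > 0"
begin

private abbreviation "w \<equiv> ab_freq p a b L"
private abbreviation "m \<equiv> a * L / (a + b)"
private abbreviation "P \<equiv> pi_p p / 2"

lemma ab_freq_pos: "w > 0"
  using a b L pi_p_pos[OF p] by (simp add: ab_freq_def)

lemma ab_peak: "0 < m" "m < L"
  using a b L by (auto simp: field_simps)

lemma ab_freq_peak: "w * m / a = P" "w * (L - m) / b = P"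
proof -
  have "a + b \<noteq> 0" "L - m = b * L / (a + b)" using a b by (auto simp: field_simps)
  moreover have "c * pi_p p / (2 * L) * (x * L / c) / x = P"
    if "x > 0" "c \<noteq> 0" for x c
    using that L by simp
  ultimately show "w * m / a = P" "w * (L - m) / b = P"
    using a b unfolding ab_freq_def by metis+
qed

lemma ab_left_range:
  shows "t \<in> {0..m} \<Longrightarrow> w * t / a \<in> {0..P}" "t \<in> {0<..<m} \<Longrightarrow> w * t / a \<in> {0<..<P}"
  unfolding ab_freq_peak(1)[symmetric] using ab_freq_pos a
  by (auto intro!: divide_right_mono mult_left_mono divide_strict_right_mono mult_strict_left_mono
      simp del: times_divide_eq_right)

lemma ab_right_range:
  shows "t \<in> {m..L} \<Longrightarrow> w * (L - t) / b \<in> {0..P}"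
    "t \<in> {m<..<L} \<Longrightarrow> w * (L - t) / b \<in> {0<..<P}"
  unfolding ab_freq_peak(2)[symmetric] using ab_freq_pos b
  by (auto intro!: divide_right_mono mult_left_mono divide_strict_right_mono mult_strict_left_mono
      simp del: times_divide_eq_right)

lemma continuous_on_ab_glue:
  assumes "continuous_on {0..P} F" "continuous_on {0..P} G" "F P = G P"
  shows "continuous_on {0..L} (\<lambda>t. if t \<le> m then F (w * t / a) else G (w * (L - t) / b))"
proof (rule continuous_on_cases_le)
  show "continuous_on {t \<in> {0..L}. t \<le> m} (\<lambda>t. F (w * t / a))"
    using a ab_left_range(1) by (intro continuous_on_compose2[OF assms(1)] continuous_intros) auto
  show "continuous_on {t \<in> {0..L}. m \<le> t} (\<lambda>t. G (w * (L - t) / b))"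
    using b ab_right_range(1) by (intro continuous_on_compose2[OF assms(2)] continuous_intros) auto
  show "F (w * t / a) = G (w * (L - t) / b)" if "t \<in> {0..L}" "t = m" for t
    using that assms(3) by (simp only: ab_freq_peak)
qed (intro continuous_intros)

text \<open>Stated for general profiles because it is applied twice: to the arch, with
  \<open>sin_p\<close> on both sides, and to its flux, with multiples of
  \<open>cos_p powr (p - 1)\<close>. The conditions at \<open>P\<close> make function and derivative
  continuous at the peak.\<close>

lemma primitive_on_ab_glue:
  assumes "continuous_on {0..P} F" "continuous_on {0..P} G" "F P = G P"
    and "continuous_on {0..P} F'" "continuous_on {0..P} G'" "w / a * F' P = - (w / b) * G' P"
    and F: "\<And>x. x \<in> {0<..<P} \<Longrightarrow> (F has_real_derivative F' x) (at x)"
    and G: "\<And>x. x \<in> {0<..<P} \<Longrightarrow> (G has_real_derivative G' x) (at x)"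
  shows "primitive_on 0 L (\<lambda>t. if t \<le> m then F (w * t / a) else G (w * (L - t) / b))
    (\<lambda>t. if t \<le> m then w / a * F' (w * t / a) else - (w / b) * G' (w * (L - t) / b))"
    (is "primitive_on 0 L ?u ?g")
proof (rule primitive_on_C1[of "{m}"])
  show "continuous_on {0..L} ?u" by (rule continuous_on_ab_glue[OF assms(1-3)])
  show "continuous_on {0..L} ?g"
    by (rule continuous_on_ab_glue[of "\<lambda>x. w / a * F' x" "\<lambda>x. - (w / b) * G' x"])
      (intro continuous_on_mult continuous_on_const assms)+
  show "(?u has_real_derivative ?g t) (at t)" if t: "t \<in> {0<..<L} - {m}" for t
  proof (cases "t < m")
    case True
    have "((\<lambda>t. F (w * t / a)) has_real_derivative F' (w * t / a) * (w / a)) (at t)"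
      using True t a ab_left_range(2)[of t]
      by (intro DERIV_chain2[OF F]) (auto intro!: derivative_eq_intros)
    then have "(?u has_real_derivative F' (w * t / a) * (w / a)) (at t)"
      by (rule has_field_derivative_transform_within_open[of _ _ _ "{..<m}"]) (use True in auto)
    then show ?thesis using True by (simp add: mult.commute)
  next
    case False
    have "((\<lambda>t. G (w * (L - t) / b)) has_real_derivative G' (w * (L - t) / b) * (- (w / b))) (at t)"
      using False t b ab_right_range(2)[of t]
      by (intro DERIV_chain2[OF G]) (auto intro!: derivative_eq_intros)
    then have "(?u has_real_derivative G' (w * (L - t) / b) * (- (w / b))) (at t)"
      by (rule has_field_derivative_transform_within_open[of _ _ _ "{m<..}"]) (use False t in auto)
    then show ?thesis using False t by (simp add: mult.commute)
  qed
qed auto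

lemma primitive_on_ab_arch: "primitive_on 0 L (ab_arch p a b L) (ab_arch_deriv p a b L)"
  unfolding ab_arch_def[abs_def] ab_arch_deriv_def[abs_def]
  using p continuous_on_sin_p continuous_on_cos_p sin_p_has_real_derivative
  by (intro primitive_on_ab_glue) auto

text \<open>Both halves arrive at the peak with \<open>cos_p\<close> equal to 0, so the different
  factors w / a and w / b do no harm.\<close>

lemma continuous_on_ab_arch_deriv: "continuous_on {0..L} (ab_arch_deriv p a b L)"
  unfolding ab_arch_deriv_def[abs_def]
  by (rule continuous_on_ab_glue[of "\<lambda>x. w / a * cos_p p x" "\<lambda>x. - (w / b) * cos_p p x"])
    (use p in \<open>auto intro!: continuous_on_mult continuous_on_minus continuous_on_const
        continuous_on_cos_p simp del: times_divide_eq_left\<close>)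

text \<open>In a^p (w/a)^(p-1) a single factor a survives. Differentiating the flux brings in w / a
  and removes that factor as well, so both halves obey the same equation with eigenvalue (p-1)
  w^p.\<close>

lemma ab_flux_ab_arch_deriv:
  "ab_flux p a b (ab_arch_deriv p a b L t) = (if t \<le> m
     then a * w powr (p - 1) * cos_p p (w * t / a) powr (p - 1)
     else - b * w powr (p - 1) * cos_p p (w * (L - t) / b) powr (p - 1))"
proof -
  have pow: "x powr p * (w / x * c) powr (p - 1) = x * w powr (p - 1) * c powr (p - 1)"
    if "x > 0" "c \<ge> 0" for x c
  proof -
    have "x powr p * (w / x * c) powr (p - 1) = x powr (p - (p - 1)) * (w powr (p - 1) * c powr (p - 1))"
      using that ab_freq_pos by (subst powr_diff) (simp add: powr_mult powr_divide)
    then show ?thesis using that by simp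
  qed
  have max0: "max (w / x * cos_p p c) 0 = w / x * cos_p p c"
    "max (- (w / x * cos_p p c)) 0 = 0" if "x > 0" for x c
    using that ab_freq_pos cos_p_nonneg[OF p, of c]
    by (simp_all add: max_absorb1 max_absorb2 del: times_divide_eq_left)
  show ?thesis
    unfolding ab_flux_def ab_arch_deriv_def
    using a b p cos_p_nonneg[OF p] by (auto simp: max0 pow simp del: times_divide_eq_left)
qed

lemma primitive_on_ab_flux:
  "primitive_on 0 L (\<lambda>t. ab_flux p a b (ab_arch_deriv p a b L t))
     (\<lambda>t. - ab_eigenvalue p a b L * ab_arch p a b L t powr (p - 1))"
proof -
  let ?F = "\<lambda>x. a * w powr (p - 1) * cos_p p x powr (p - 1)"
  let ?G = "\<lambda>x. - b * w powr (p - 1) * cos_p p x powr (p - 1)"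
  let ?F' = "\<lambda>x. a * w powr (p - 1) * (- (p - 1) * sin_p p x powr (p - 1))"
  let ?G' = "\<lambda>x. - b * w powr (p - 1) * (- (p - 1) * sin_p p x powr (p - 1))"
  have cc: "continuous_on {0..P} (\<lambda>x. cos_p p x powr (p - 1))"
    using p cos_p_nonneg by (intro continuous_on_powr' continuous_on_cos_p continuous_intros) auto
  have cs: "continuous_on {0..P} (\<lambda>x. sin_p p x powr (p - 1))"
    using p sin_p_range[OF p]
    by (intro continuous_on_powr' continuous_on_sin_p continuous_intros) auto
  have prim: "primitive_on 0 L (\<lambda>t. if t \<le> m then ?F (w * t / a) else ?G (w * (L - t) / b))
    (\<lambda>t. if t \<le> m then w / a * ?F' (w * t / a) else - (w / b) * ?G' (w * (L - t) / b))"
  proof (rule primitive_on_ab_glue)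
    show "(?F has_real_derivative ?F' x) (at x)" "(?G has_real_derivative ?G' x) (at x)"
      if "x \<in> {0<..<P}" for x
      using cos_p_powr_has_real_derivative[OF p, of x] that by (fastforce intro: DERIV_cmult)+
    show "w / a * ?F' P = - (w / b) * ?G' P" using a b by simp
  qed (use cc cs p in \<open>auto intro!: continuous_intros\<close>)
  have "w * w powr (p - 1) = w powr p"
    using ab_freq_pos by (simp add: powr_mult_base)
  then have eig: "ab_eigenvalue p a b L = (p - 1) * (w * w powr (p - 1))"
    by (simp add: ab_eigenvalue_def)
  have arith: "w / x * (x * y * (- (p - 1) * z)) = - ((p - 1) * (w * y)) * z"
    "- (w / x) * (- x * y * (- (p - 1) * z)) = - ((p - 1) * (w * y)) * z" if "x > 0" for x y z
    using that by (auto simp: field_simps)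
  have "w / a * a = w" "w / b * b = w" using a b by auto
  then show ?thesis
    by (intro primitive_on_cong[OF prim])
      (simp_all add: ab_flux_ab_arch_deriv ab_arch_def eig arith[OF a] arith[OF b]
        del: times_divide_eq_left mult_minus_left mult_minus_right minus_diff_eq)
qed

lemma ab_arch_0 [simp]: "ab_arch p a b L 0 = 0"
  using ab_peak p by (simp add: ab_arch_def)

lemma ab_arch_L [simp]: "ab_arch p a b L L = 0"
  using ab_peak p by (simp add: ab_arch_def)

lemma ab_arch_range: "t \<in> {0..L} \<Longrightarrow> ab_arch p a b L t \<in> {0..1}"
  using sin_p_range[OF p] ab_left_range(1)[of t] ab_right_range(1)[of t] by (auto simp: ab_arch_def)

lemma ab_arch_pos: "t \<in> {0<..<L} \<Longrightarrow> ab_arch p a b L t > 0"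
  using sin_p_pos[OF p, of "w * t / a"] sin_p_pos[OF p, of "w * (L - t) / b"]
    ab_left_range(1)[of t] ab_right_range(1)[of t] ab_freq_pos a b
  by (auto simp: ab_arch_def)

text \<open>The peak is unique and its position encodes the ratio of a and b; this is how the final
  claim recovers a = b from the arches.\<close>

lemma ab_arch_eq_1_iff: "t \<in> {0..L} \<Longrightarrow> ab_arch p a b L t = 1 \<longleftrightarrow> t = m"
proof -
  assume t: "t \<in> {0..L}"
  have 1: "w * t / a = P \<longleftrightarrow> t = m"
    unfolding ab_freq_peak(1)[symmetric] using a ab_freq_pos
    by (simp del: times_divide_eq_right)
  have 2: "w * (L - t) / b = P \<longleftrightarrow> t = m"
    unfolding ab_freq_peak(2)[symmetric] using b ab_freq_pos
    by (simp del: times_divide_eq_right)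
  show ?thesis
    unfolding ab_arch_def
    using sin_p_eq_1_iff[OF p ab_left_range(1), of t] sin_p_eq_1_iff[OF p ab_right_range(1), of t] t
    by (simp only: 1 2 atLeastAtMost_iff split: if_split) (meson linear)
qed

private abbreviation "arch \<equiv> ab_arch p a b L"
private abbreviation "arch' \<equiv> ab_arch_deriv p a b L"
private abbreviation "flux t \<equiv> ab_flux p a b (arch' t)"
private abbreviation "lam \<equiv> ab_eigenvalue p a b L"

lemma ab_arch_has_real_derivative:
  assumes "t \<in> {0<..<L}"
  shows "(arch has_real_derivative arch' t) (at t)"
  using primitive_on_has_real_derivative[OF primitive_on_ab_arch
      continuous_on_ab_arch_deriv, of t] assms
  by (simp add: at_within_Icc_at)

lemma ab_flux_arch_has_real_derivative:
  assumes "t \<in> {0<..<L}"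
  shows "(flux has_real_derivative - lam * arch t powr (p - 1)) (at t)"
proof -
  have "continuous_on {0..L} (\<lambda>t. - lam * arch t powr (p - 1))"
    using p ab_arch_range primitive_on_continuous[OF primitive_on_ab_arch]
    by (intro continuous_on_mult continuous_on_const continuous_on_powr') auto
  then show ?thesis
    using primitive_on_has_real_derivative[OF primitive_on_ab_flux, of t] assms
    by (simp add: at_within_Icc_at)
qed

text \<open>The Riccati equation behind Picone's identity: in q \<psi>^(1-p) the power of \<psi>
  from the flux equation cancels, which leaves the constant -\<Lambda>.\<close>

lemma ab_riccati_has_real_derivative:
  assumes "t \<in> {0<..<L}"
  shows "((\<lambda>t. flux t * arch t powr (1 - p)) has_real_derivative
    - lam - (p - 1) * (flux t * arch' t * arch t powr (- p))) (at t)"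
proof -
  have pos: "arch t > 0" using ab_arch_pos assms by simp
  have 1: "((\<lambda>t. arch t powr (1 - p)) has_real_derivative (1 - p) * arch t powr (1 - p - 1) * arch' t) (at t)"
    by (rule derivative_eq_intros ab_arch_has_real_derivative assms pos refl | simp)+
  have 2: "((\<lambda>t. flux t * arch t powr (1 - p)) has_real_derivative
     - lam * arch t powr (p - 1) * arch t powr (1 - p)
     + (1 - p) * arch t powr (1 - p - 1) * arch' t * flux t) (at t)"
    by (rule DERIV_mult[OF ab_flux_arch_has_real_derivative[OF assms] 1])
  have "arch t powr (p - 1) * arch t powr (1 - p) = 1"
    using pos by (simp flip: powr_add)
  then have "- lam * arch t powr (p - 1) * arch t powr (1 - p) = - lam"
    by (simp add: mult.assoc)
  moreover have "1 - p - 1 = - p" by simp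
  ultimately show ?thesis using 2 by (simp only:) (simp add: algebra_simps)
qed

text \<open>Each half inherits the bound for \<open>sin_p\<close> with constant K a / w or K b / w;
  the sum a + b dominates both.\<close>

lemma ab_arch_linear_lower_bound:
  obtains K where "K > 0" "\<And>t. t \<in> {0..L} \<Longrightarrow> min t (L - t) \<le> K * ab_arch p a b L t"
proof -
  obtain K where K: "K > 0" "\<And>t. t \<in> {0..P} \<Longrightarrow> t \<le> K * sin_p p t"
    using sin_p_linear_lower_bound[OF p] by blast
  show ?thesis
  proof (rule that)
    show "K * (a + b) / w > 0" using K a b ab_freq_pos by simp
    show "min t (L - t) \<le> K * (a + b) / w * ab_arch p a b L t" if t: "t \<in> {0..L}" for t
    proof (cases "t \<le> m")
      case True
      have "w * t / a \<le> K * ab_arch p a b L t"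
        using K(2)[OF ab_left_range(1)] True t by (simp add: ab_arch_def)
      then have "t \<le> K * a / w * ab_arch p a b L t"
        using ab_freq_pos a by (simp add: field_simps)
      also have "\<dots> \<le> K * (a + b) / w * ab_arch p a b L t"
        using ab_freq_pos a b K ab_arch_range[OF t]
        by (intro mult_right_mono divide_right_mono mult_left_mono) auto
      finally show ?thesis by linarith
    next
      case False
      have "w * (L - t) / b \<le> K * ab_arch p a b L t"
        using K(2)[OF ab_right_range(1)] False t by (simp add: ab_arch_def)
      then have "L - t \<le> K * b / w * ab_arch p a b L t"
        using ab_freq_pos b by (simp add: field_simps)
      also have "\<dots> \<le> K * (a + b) / w * ab_arch p a b L t"
        using ab_freq_pos a b K ab_arch_range[OF t]
        by (intro mult_right_mono divide_right_mono mult_left_mono) auto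
      finally show ?thesis by linarith
    qed
  qed
qed

end

section \<open>Young's inequality\<close>

text \<open>The convex function x^p lies strictly above its tangent at y. Between positive arguments
  this is the mean value theorem with a strictly increasing derivative; zero arguments are split
  off, since \<open>powr\<close> is differentiated at positive bases.\<close>

lemma young_powr_strict:
  fixes x y p :: real
  assumes "p > 1" "x \<ge> 0" "y \<ge> 0" "x \<noteq> y"
  shows "p * y powr (p - 1) * x < x powr p + (p - 1) * y powr p"
proof -
  consider "x = 0" "y > 0" | "x > 0" "y = 0" | "0 < x" "x < y" | "0 < y" "y < x"
    using assms by linarith
  then show ?thesis
  proof cases
    case 3
    obtain z where z: "x < z" "z < y" "y powr p - x powr p = (y - x) * (p * z powr (p - 1))"
      using MVT2[OF 3(2), of "\<lambda>x. x powr p" "\<lambda>x. p * x powr (p - 1)"] 3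
      by (force intro!: derivative_eq_intros)
    have "z powr (p - 1) < y powr (p - 1)" using z 3 assms by (intro powr_less_mono2) auto
    then have "(y - x) * (p * z powr (p - 1)) < (y - x) * (p * y powr (p - 1))"
      using 3 assms by (intro mult_strict_left_mono) auto
    moreover have "y * y powr (p - 1) = y powr p" using 3 by (simp add: powr_mult_base)
    ultimately show ?thesis using z(3) by (simp add: algebra_simps)
  next
    case 4
    obtain z where z: "y < z" "z < x" "x powr p - y powr p = (x - y) * (p * z powr (p - 1))"
      using MVT2[OF 4(2), of "\<lambda>x. x powr p" "\<lambda>x. p * x powr (p - 1)"] 4
      by (force intro!: derivative_eq_intros)
    have "y powr (p - 1) < z powr (p - 1)" using z 4 assms by (intro powr_less_mono2) auto
    then have "(x - y) * (p * y powr (p - 1)) < (x - y) * (p * z powr (p - 1))"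
      using 4 assms by (intro mult_strict_left_mono) auto
    moreover have "y * y powr (p - 1) = y powr p" using 4 by (simp add: powr_mult_base)
    ultimately show ?thesis using z(3) by (simp add: algebra_simps)
  qed (use assms in auto)
qed

lemma young_powr:
  fixes x y p :: real
  assumes "p > 1" "x \<ge> 0" "y \<ge> 0"
  shows "p * y powr (p - 1) * x \<le> x powr p + (p - 1) * y powr p"
proof (cases "x = y")
  case True
  then show ?thesis using assms by (cases "y = 0") (auto simp: algebra_simps powr_mult_base)
qed (use young_powr_strict[OF assms] in auto)

section \<open>Homogeneity and convexity of the asymmetric energy density\<close>

lemma ab_flux_uminus: "ab_flux p a b (- x) = - ab_flux p b a x"
  by (simp add: ab_flux_def)

lemma ab_energy_uminus: "ab_energy p a b (- x) = ab_energy p b a x"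
  by (simp add: ab_energy_def)

lemma ab_flux_mult_pos:
  assumes "c > 0"
  shows "ab_flux p a b (c * x) = c powr (p - 1) * ab_flux p a b x"
proof -
  have "max (c * y) 0 = c * max y 0" for y
    using assms by (auto simp: max_def mult_le_0_iff)
  from this[of x] this[of "- x"] show ?thesis
    using assms by (simp add: ab_flux_def powr_mult algebra_simps)
qed

lemma ab_flux_times_self:
  assumes "p > 1"
  shows "ab_flux p a b x * x = ab_energy p a b x"
proof (cases "x \<ge> 0")
  case True
  have "ab_flux p a b x * x = a powr p * (x * x powr (p - 1))"
    using True by (simp add: ab_flux_def)
  then show ?thesis
    using True assms powr_mult_base[of x "p - 1"] by (simp add: ab_energy_def)
next
  case False
  have "ab_flux p a b x * x = b powr p * (- x * (- x) powr (p - 1))"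
    using False by (simp add: ab_flux_def)
  also have "- x * (- x) powr (p - 1) = (- x) powr p"
    using False powr_mult_base[of "- x" "p - 1"] by simp
  finally show ?thesis
    using False by (simp add: ab_energy_def)
qed

lemma ab_energy_nonneg: "0 \<le> ab_energy p a b x"
  by (simp add: ab_energy_def)

text \<open>The derivative of \<open>ab_energy\<close> is p times \<open>ab_flux\<close>, so this is
  the strict tangent inequality at z for a convex function. If x < 0 <= z, the left side is at most
  0 while the energy of x is positive.\<close>

lemma ab_young_strict_nonneg:
  assumes "p > 1" "a > 0" "b > 0" "x \<noteq> z" "z \<ge> 0"
  shows "p * ab_flux p a b z * x < ab_energy p a b x + (p - 1) * (ab_flux p a b z * z)"
proof -
  have f: "ab_flux p a b z = a powr p * z powr (p - 1)" "ab_flux p a b z * z = a powr p * z powr p"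
    using assms ab_flux_times_self[of p a b z] by (simp_all add: ab_flux_def ab_energy_def)
  show ?thesis
  proof (cases "x \<ge> 0")
    case True
    have "a powr p * (p * z powr (p - 1) * x) < a powr p * (x powr p + (p - 1) * z powr p)"
      using young_powr_strict[of p x z] assms True by (intro mult_strict_left_mono) auto
    then show ?thesis using True unfolding f(2) unfolding f(1)
      by (simp add: ab_energy_def algebra_simps)
  next
    case False
    have "p * ab_flux p a b z * x \<le> 0"
      using False assms unfolding f(1) by (intro mult_nonneg_nonpos) auto
    moreover have "0 < ab_energy p a b x" using False assms by (simp add: ab_energy_def)
    moreover have "0 \<le> (p - 1) * (ab_flux p a b z * z)" unfolding f(2) using assms by simp
    ultimately show ?thesis by linarith
  qed
qed

lemma ab_young_strict:
  assumes "p > 1" "a > 0" "b > 0" "x \<noteq> z"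
  shows "p * ab_flux p a b z * x < ab_energy p a b x + (p - 1) * (ab_flux p a b z * z)"
proof (cases "z \<ge> 0")
  case True
  then show ?thesis using ab_young_strict_nonneg assms by blast
next
  case False
  have "p * ab_flux p b a (- z) * (- x) < ab_energy p b a (- x) + (p - 1) * (ab_flux p b a (- z) * (- z))"
    using False assms by (intro ab_young_strict_nonneg) auto
  then show ?thesis by (simp add: ab_flux_uminus ab_energy_uminus)
qed

lemma ab_young:
  assumes "p > 1" "a > 0" "b > 0"
  shows "p * ab_flux p a b z * x \<le> ab_energy p a b x + (p - 1) * (ab_flux p a b z * z)"
proof (cases "x = z")
  case True
  then show ?thesis using assms ab_flux_times_self[of p a b z] by (simp add: algebra_simps)
qed (use ab_young_strict[OF assms] in force)

lemma borel_measurable_ab_energy [measurable]: "ab_energy p a b \<in> borel_measurable borel"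
  unfolding ab_energy_def[abs_def] by measurable

section \<open>Powers of the positive part, null sets and Hoelder's inequality\<close>

lemma pos_part_powr_has_real_derivative:
  fixes p x :: real
  assumes "p > 1"
  shows "((\<lambda>x. max x 0 powr p) has_real_derivative p * max x 0 powr (p - 1)) (at x)"
proof (cases x "0::real" rule: linorder_cases)
  case less
  have "((\<lambda>x. 0) has_real_derivative 0) (at x)" by simp
  then have "((\<lambda>x. max x 0 powr p) has_real_derivative 0) (at x)"
    by (rule has_field_derivative_transform_within_open[of _ _ _ "{..<0}"]) (use less assms in auto)
  then show ?thesis using less by simp
next
  case greater
  have "((\<lambda>x. x powr p) has_real_derivative p * x powr (p - 1)) (at x)"
    using greater by (auto intro!: derivative_eq_intros)
  then have "((\<lambda>x. max x 0 powr p) has_real_derivative p * x powr (p - 1)) (at x)"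
    by (rule has_field_derivative_transform_within_open[of _ _ _ "{0<..}"]) (use greater in auto)
  then show ?thesis using greater by simp
next
  case equal
  have "isCont (\<lambda>y::real. max y 0 powr (p - 1)) 0"
    using assms by (intro continuous_on_interior[of UNIV] continuous_on_powr' continuous_intros) auto
  then have "((\<lambda>y::real. max y 0 powr (p - 1)) \<longlongrightarrow> 0) (at 0)"
    using isContD by fastforce
  \<comment> \<open>At 0 the difference quotient of max(y,0)^p is max(y,0)^(p-1) itself, on either
    side.\<close>
  then have "((\<lambda>y::real. (max y 0 powr p - max 0 0 powr p) / (y - 0)) \<longlongrightarrow> 0) (at 0)"
    by (rule Lim_transform_within[where d = 1]) (auto simp: max_def powr_diff)
  then show ?thesis using equal by (simp add: has_field_derivative_iff)
qed

lemma primitive_on_pos_part_powr: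
  assumes "p > 1" "primitive_on a b u g"
  shows "primitive_on a b (\<lambda>t. max (u t) 0 powr p) (\<lambda>t. p * max (u t) 0 powr (p - 1) * g t)"
  using assms pos_part_powr_has_real_derivative
  by (intro primitive_on_chain[where F' = "\<lambda>x. p * max x 0 powr (p - 1)"] continuous_intros
      continuous_on_powr') auto

lemma has_integral_0_nonneg_imp_negligible:
  fixes f :: "real \<Rightarrow> real"
  assumes "f absolutely_integrable_on {a..b}" "(f has_integral 0) {a..b}"
    and "\<And>t. t \<in> {a..b} \<Longrightarrow> f t \<ge> 0"
  shows "negligible {t \<in> {a..b}. f t \<noteq> 0}"
proof -
  have int: "integrable lebesgue (\<lambda>x. indicator {a..b} x *\<^sub>R f x)"
    using assms(1) by (simp add: set_integrable_def)
  have "(LINT x:{a..b}|lebesgue. f x) = 0"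
    using assms(1,2) by (simp add: set_lebesgue_integral_eq_integral integral_unique)
  then have "integral\<^sup>L lebesgue (\<lambda>x. indicator {a..b} x *\<^sub>R f x) = 0"
    by (simp add: set_lebesgue_integral_def)
  moreover have "AE x in lebesgue. 0 \<le> indicator {a..b} x *\<^sub>R f x"
    using assms(3) by (auto simp: indicator_def)
  ultimately have "AE x in lebesgue. indicator {a..b} x *\<^sub>R f x = 0"
    using integral_nonneg_eq_0_iff_AE[OF int] by blast
  then obtain N where "negligible N" "{x. indicator {a..b} x *\<^sub>R f x \<noteq> 0} \<subseteq> N"
    unfolding eventually_ae_filter_negligible by blast
  then show ?thesis
    by (elim negligible_subset) (auto simp: indicator_def)
qed

text \<open>Hoelder's inequality, obtained by integrating Young's inequality against the mean slope.\<close>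
lemma primitive_on_powr_le:
  assumes p: "p > 1" and u: "primitive_on a b u g"
    and M: "primitive_on a b M (\<lambda>t. \<bar>g t\<bar> powr p)"
    and st: "a \<le> s" "s \<le> t" "t \<le> b"
  shows "\<bar>u t - u s\<bar> powr p \<le> (t - s) powr (p - 1) * (M t - M s)"
proof (cases "s = t")
  case False
  then have ts: "t - s > 0" using st by simp
  define m where "m = \<bar>u t - u s\<bar> / (t - s)"
  \<comment> \<open>With this sign \<open>\<sigma> * g\<close> integrates to the absolute increment
    and stays below \<open>\<bar>g\<bar>\<close>.\<close>
  define \<sigma> where "\<sigma> = sgn (u t - u s)"
  have m: "m \<ge> 0" using ts by (simp add: m_def)
  have 1: "((\<lambda>x. (p * m powr (p - 1) * \<sigma>) * g x) has_integral
      (p * m powr (p - 1) * \<sigma>) * (u t - u s)) {s..t}"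
    by (intro has_integral_mult_right primitive_on_has_integral[OF u] st)
  have 2: "((\<lambda>x. \<bar>g x\<bar> powr p + (p - 1) * m powr p) has_integral
      (M t - M s) + (t - s) *\<^sub>R ((p - 1) * m powr p)) {s..t}"
    using has_integral_const_real[of "(p - 1) * m powr p" s t] st
    by (intro has_integral_add primitive_on_has_integral[OF M]) auto
  have "(p * m powr (p - 1) * \<sigma>) * g x \<le> \<bar>g x\<bar> powr p + (p - 1) * m powr p" for x
  proof -
    have "\<sigma> * g x \<le> \<bar>g x\<bar>" by (auto simp: \<sigma>_def sgn_if)
    then have "p * m powr (p - 1) * (\<sigma> * g x) \<le> p * m powr (p - 1) * \<bar>g x\<bar>"
      using p by (intro mult_left_mono) auto
    also have "\<dots> \<le> \<bar>g x\<bar> powr p + (p - 1) * m powr p"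
      using young_powr[of p "\<bar>g x\<bar>" m] p m by simp
    finally show ?thesis by (simp add: mult.assoc)
  qed
  with has_integral_le[OF 1 2]
  have "p * m powr (p - 1) * (\<sigma> * (u t - u s)) \<le> (M t - M s) + (t - s) * ((p - 1) * m powr p)"
    by (simp add: mult.assoc)
  moreover have "\<sigma> * (u t - u s) = m * (t - s)"
    using ts by (auto simp: \<sigma>_def m_def sgn_if)
  moreover have "m powr (p - 1) * m = m powr p"
    using powr_mult_base[of m "p - 1"] m p by (simp add: mult.commute)
  ultimately have "p * (m powr p * (t - s)) \<le> (M t - M s) + (t - s) * ((p - 1) * m powr p)"
    by (metis mult.assoc)
  then have "m powr p * (t - s) \<le> M t - M s" by (simp add: algebra_simps)
  then have "(t - s) powr (p - 1) * (m powr p * (t - s)) \<le> (t - s) powr (p - 1) * (M t - M s)"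
    by (intro mult_left_mono) auto
  moreover have "(t - s) powr (p - 1) * (m powr p * (t - s)) = \<bar>u t - u s\<bar> powr p"
    using ts by (simp add: m_def powr_divide powr_diff)
  ultimately show ?thesis by simp
qed auto

section \<open>The calibration\<close>

lemma powr_base_inject:
  fixes x y p :: real
  assumes "p > 0" "x \<ge> 0" "y \<ge> 0" "x powr p = y powr p"
  shows "x = y"
  using powr_less_mono2[of p x y] powr_less_mono2[of p y x] assms
  by (cases x y rule: linorder_cases) auto

context
  fixes p a b L :: real and u g :: "real \<Rightarrow> real"
  assumes p: "p > 1" and a: "a > 0" and b: "b > 0" and L: "L > 0"
    and u: "primitive_on 0 L u g" and u0: "u 0 = 0" and uL: "u L = 0"
    and gp: "(\<lambda>t. \<bar>g t\<bar> powr p) absolutely_integrable_on {0..L}"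
begin

private abbreviation "\<psi> \<equiv> ab_arch p a b L"
private abbreviation "\<psi>' \<equiv> ab_arch_deriv p a b L"
private abbreviation "q t \<equiv> ab_flux p a b (\<psi>' t)"
private abbreviation "\<Lambda> \<equiv> ab_eigenvalue p a b L"
private abbreviation "v t \<equiv> max (u t) 0"
private abbreviation "B t \<equiv> q t * \<psi> t powr (1 - p) * v t powr p"
private abbreviation "r' t \<equiv> - \<Lambda> - (p - 1) * (q t * \<psi>' t * \<psi> t powr (- p))"
private abbreviation "B' t \<equiv> r' t * v t powr p + q t * \<psi> t powr (1 - p) * (p * v t powr (p - 1) * g t)"
private abbreviation "E t \<equiv> (if u t > 0 then ab_energy p a b (g t) else 0)"

text \<open>Only inside (0,L), where \<psi> is bounded away from 0 on compact intervals and
  \<open>\<psi> powr (1 - p)\<close> is therefore smooth enough.\<close>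

lemma primitive_on_calibration:
  assumes "0 < s" "t < L"
  shows "primitive_on s t B B'"
proof -
  have sub: "{s..t} \<subseteq> {0..L}" "{s..t} \<subseteq> {0<..<L}" using assms by auto
  have c\<psi>: "continuous_on {s..t} \<psi>"
    using continuous_on_subset[OF primitive_on_continuous[OF primitive_on_ab_arch[OF p a b L]] sub(1)] .
  have c\<psi>': "continuous_on {s..t} \<psi>'"
    using continuous_on_subset[OF continuous_on_ab_arch_deriv[OF p a b L] sub(1)] .
  have cq: "continuous_on {s..t} q"
    using continuous_on_subset[OF primitive_on_continuous[OF primitive_on_ab_flux[OF p a b L]] sub(1)] .
  have nz: "\<psi> x \<noteq> 0" if "x \<in> {s..t}" for x
    using ab_arch_pos[OF p a b L, of x] that sub by force
  have "primitive_on s t (\<lambda>t. q t * \<psi> t powr (1 - p)) r'"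
  proof (rule primitive_on_C1[of "{}"])
    show "continuous_on {s..t} (\<lambda>t. q t * \<psi> t powr (1 - p))" "continuous_on {s..t} r'"
      using nz by (intro continuous_on_mult continuous_on_diff continuous_on_powr continuous_on_const
          c\<psi> c\<psi>' cq ballI; blast)+
  qed (use ab_riccati_has_real_derivative[OF p a b L] assms in auto)
  moreover have "primitive_on s t (\<lambda>t. v t powr p) (\<lambda>t. p * v t powr (p - 1) * g t)"
    using primitive_on_subinterval[OF u] assms
    by (intro primitive_on_pos_part_powr p) auto
  ultimately show ?thesis by (rule primitive_on_mult)
qed

text \<open>Picone's inequality; the defect is that of Young's inequality between \<open>g\<close>
  and \<open>u \<psi>' / \<psi>\<close>.\<close>
lemma calibration_inequality:
  assumes t: "t \<in> {0<..<L}"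
  shows "B' t + \<Lambda> * v t powr p \<le> E t"
    and "B' t + \<Lambda> * v t powr p = E t \<Longrightarrow> u t > 0 \<Longrightarrow> g t = u t * \<psi>' t / \<psi> t"
proof -
  have pos: "\<psi> t > 0" using ab_arch_pos[OF p a b L] t by simp
  have eq: "B' t + \<Lambda> * v t powr p = p * ab_flux p a b z * g t - (p - 1) * (ab_flux p a b z * z)"
    if "u t > 0" "z = u t * \<psi>' t / \<psi> t" for z
  proof -
    have z: "z = (u t / \<psi> t) * \<psi>' t" using that by simp
    have f1: "ab_flux p a b z = q t * \<psi> t powr (1 - p) * u t powr (p - 1)"
      unfolding z using that pos by (subst ab_flux_mult_pos)
        (auto simp: powr_divide powr_minus_divide[of _ "p - 1", simplified])
    have "\<psi> t powr (1 - p) = \<psi> t * \<psi> t powr (- p)" "u t powr p = u t * u t powr (p - 1)"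
      using that pos by (simp_all add: powr_mult_base)
    then have f2: "ab_flux p a b z * z = q t * \<psi>' t * \<psi> t powr (- p) * u t powr p"
      unfolding f1 unfolding that using pos by simp
    show ?thesis unfolding f2 unfolding f1 using that by (simp add: algebra_simps)
  qed
  show "B' t + \<Lambda> * v t powr p \<le> E t"
    \<comment> \<open>Where \<open>u t \<le> 0\<close> both sides are 0, since \<open>v t\<close> is
      0 and \<open>E\<close> is cut off.\<close>
    using ab_young[OF p a b, of "u t * \<psi>' t / \<psi> t" "g t"] eq[OF _ refl]
    by (cases "u t > 0") auto
  show "g t = u t * \<psi>' t / \<psi> t" if "B' t + \<Lambda> * v t powr p = E t" "u t > 0"
    using ab_young_strict[OF p a b, of "g t" "u t * \<psi>' t / \<psi> t"] eq[OF that(2) refl] that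
    by auto
qed

lemma calibration_0: "B 0 = 0" "B L = 0"
  using u0 uL by auto

text \<open>At an endpoint \<open>B\<close> is 0 because \<open>v\<close> is, and the content is
  that 0 is also its limit. At distance d from the endpoint, |u|^p is at most d^(p-1) times the
  integral of |g|^p in between, and \<psi> is at least d / K. The powers of d cancel, and that
  integral tends to 0.\<close>

lemma continuous_on_calibration: "continuous_on {0..L} B"
proof -
  define M where "M t = integral {0..t} (\<lambda>t. \<bar>g t\<bar> powr p)" for t
  have M: "primitive_on 0 L M (\<lambda>t. \<bar>g t\<bar> powr p)"
    unfolding M_def by (rule primitive_on_integral[OF gp])
  have cM: "continuous_on {0..L} M" by (rule primitive_on_continuous[OF M])
  have M0: "M 0 = 0" by (simp add: M_def)
  obtain K where K: "K > 0" "\<And>t. t \<in> {0..L} \<Longrightarrow> min t (L - t) \<le> K * \<psi> t"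
    using ab_arch_linear_lower_bound[OF p a b L] by blast
  have "bounded (q ` {0..L})"
    using primitive_on_continuous[OF primitive_on_ab_flux[OF p a b L]] compact_continuous_image
      compact_imp_bounded compact_Icc by blast
  then obtain Q where Q: "Q > 0" "\<And>t. t \<in> {0..L} \<Longrightarrow> \<bar>q t\<bar> \<le> Q"
    unfolding bounded_pos by (metis imageI real_norm_def)
  \<comment> \<open>Keeping the distance \<open>d\<close> and the energy \<open>N\<close> as
    parameters lets one estimate serve both ends.\<close>
  have bound: "\<bar>B t\<bar> \<le> Q * K powr (p - 1) * N"
    if t: "t \<in> {0<..<L}" and d: "0 < d" "d \<le> min t (L - t)" and N: "\<bar>u t\<bar> powr p \<le> d powr (p - 1) * N"
    for t d N
  proof -
    have pos: "\<psi> t > 0" using ab_arch_pos[OF p a b L] t by simp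
    have "d / K \<le> \<psi> t" using K(2)[of t] K(1) t d by (auto simp: field_simps)
    then have 1: "\<psi> t powr (1 - p) \<le> (d / K) powr (1 - p)"
      using K d p pos by (intro powr_mono2') auto
    have 2: "v t powr p \<le> \<bar>u t\<bar> powr p" using p by (intro powr_mono2) auto
    have "\<bar>B t\<bar> = \<bar>q t\<bar> * \<psi> t powr (1 - p) * v t powr p" by (simp add: abs_mult)
    also have "\<dots> \<le> Q * (d / K) powr (1 - p) * (d powr (p - 1) * N)"
      using Q(2)[of t] Q(1) t 1 2 N by (intro mult_mono) auto
    also have "\<dots> = Q * K powr (p - 1) * N * (d powr (1 - p) * d powr (p - 1))"
      using K(1) d by (simp add: powr_divide powr_diff field_simps)
    also have "d powr (1 - p) * d powr (p - 1) = 1"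
      using d by (simp flip: powr_add)
    finally show ?thesis by simp
  qed
  have left: "\<bar>B t\<bar> \<le> Q * K powr (p - 1) * M t" if "t \<in> {0..L/2}" for t
  proof (cases "t = 0")
    case False
    then show ?thesis
      using primitive_on_powr_le[OF p u M, of 0 t] that L u0 M0 by (intro bound[of t t]) auto
  qed (use calibration_0 M0 in auto)
  have right: "\<bar>B t\<bar> \<le> Q * K powr (p - 1) * (M L - M t)" if "t \<in> {L/2..L}" for t
  proof (cases "t = L")
    case False
    then show ?thesis
      using primitive_on_powr_le[OF p u M, of t L] that L uL by (intro bound[of t "L - t"]) auto
  qed (use calibration_0 in auto)
  show ?thesis
    unfolding continuous_on_eq_continuous_within
  proof
    fix x assume x: "x \<in> {0..L}"
    consider "x = 0" | "x = L" | "x \<in> {0<..<L}" using x by force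
    then show "continuous (at x within {0..L}) B"
    proof cases
      case 1
      have "((\<lambda>t. Q * K powr (p - 1) * M t) \<longlongrightarrow> Q * K powr (p - 1) * M 0) (at 0 within {0..L})"
        using cM L by (intro tendsto_intros) (auto simp: continuous_on_def)
      then have lim: "((\<lambda>t. Q * K powr (p - 1) * M t) \<longlongrightarrow> 0) (at 0 within {0..L})"
        by (simp add: M0)
      have "eventually (\<lambda>t. norm (B t) \<le> Q * K powr (p - 1) * M t) (at 0 within {0..L})"
        unfolding eventually_at using left L by (intro exI[of _ "L/2"]) (auto simp: dist_real_def)
      from Lim_null_comparison[OF this lim] show ?thesis
        unfolding 1 continuous_within calibration_0 .
    next
      case 2
      have "((\<lambda>t. Q * K powr (p - 1) * (M L - M t)) \<longlongrightarrow> Q * K powr (p - 1) * (M L - M L))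
          (at L within {0..L})"
        using cM L by (intro tendsto_intros) (auto simp: continuous_on_def)
      then have lim: "((\<lambda>t. Q * K powr (p - 1) * (M L - M t)) \<longlongrightarrow> 0) (at L within {0..L})"
        by simp
      have "eventually (\<lambda>t. norm (B t) \<le> Q * K powr (p - 1) * (M L - M t)) (at L within {0..L})"
        unfolding eventually_at using right L by (intro exI[of _ "L/2"]) (auto simp: dist_real_def)
      from Lim_null_comparison[OF this lim] show ?thesis
        unfolding 2 continuous_within calibration_0 .
    next
      case 3
      then have "continuous_on {x/2..(x+L)/2} B"
        by (intro primitive_on_continuous[OF primitive_on_calibration]) auto
      moreover have "x \<in> interior {x/2..(x+L)/2}" using 3 by auto
      ultimately have "isCont B x" by (rule continuous_on_interior)
      then show ?thesis by (rule continuous_at_imp_continuous_at_within)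
    qed
  qed
qed

lemma ab_energy_absolutely_integrable:
  "(\<lambda>t. ab_energy p a b (g t)) absolutely_integrable_on {0..L}"
proof (rule measurable_bounded_by_integrable_imp_absolutely_integrable)
  have "g absolutely_integrable_on {0..L}" using u by (simp add: primitive_on_def)
  then have "g \<in> borel_measurable (lebesgue_on {0..L})"
    by (intro absolutely_integrable_imp_borel_measurable) auto
  then show "(\<lambda>t. ab_energy p a b (g t)) \<in> borel_measurable (lebesgue_on {0..L})"
    by measurable
  show "(\<lambda>t. (a powr p + b powr p) * \<bar>g t\<bar> powr p) integrable_on {0..L}"
    using gp set_lebesgue_integral_eq_integral(1) integrable_on_mult_right by blast
  show "norm (ab_energy p a b (g t)) \<le> (a powr p + b powr p) * \<bar>g t\<bar> powr p" for t
    using p by (auto simp: ab_energy_def max_def algebra_simps)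
qed auto

lemma pos_energy_absolutely_integrable: "E absolutely_integrable_on {0..L}"
proof -
  have [measurable]: "u \<in> borel_measurable (lebesgue_on {0..L})"
    using primitive_on_continuous[OF u] by (intro continuous_imp_measurable_on_sets_lebesgue) auto
  have "(\<lambda>t. indicator {0<..} (u t) * ab_energy p a b (g t)) absolutely_integrable_on {0..L}"
  proof (rule absolutely_integrable_bounded_measurable_product_real)
    show "(\<lambda>t. indicator {0<..} (u t) :: real) \<in> borel_measurable (lebesgue_on {0..L})"
      by measurable
    show "bounded ((\<lambda>t. indicator {0<..} (u t) :: real) ` {0..L})"
      unfolding bounded_iff by (intro exI[of _ 1]) (auto simp: indicator_def)
  qed (use ab_energy_absolutely_integrable in auto)
  moreover have "(\<lambda>t. indicator {0<..} (u t) * ab_energy p a b (g t)) = E"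
    by (auto simp: indicator_def)
  ultimately show ?thesis by simp
qed

lemma pos_part_powr_continuous: "continuous_on {0..L} (\<lambda>t. v t powr p)"
  using primitive_on_continuous[OF primitive_on_pos_part_powr[OF p u]] .

text \<open>The function \<open>G\<close> accumulates the defect of Picone's inequality. It is
  nondecreasing inside (0,L) and continuous up to the ends, with \<open>G 0 = 0\<close> and
  \<open>G L\<close> the difference of the two sides. If that difference is 0, then \<open>G\<close>
  vanishes and the defect is 0 almost everywhere.\<close>

lemma pos_part_energy:
  shows pos_part_energy_ge:
      "\<Lambda> * integral {0..L} (\<lambda>t. v t powr p) \<le> integral {0..L} E"
    and pos_part_energy_eq:
      "\<Lambda> * integral {0..L} (\<lambda>t. v t powr p) = integral {0..L} E \<Longrightarrow>
        \<exists>c\<ge>0. \<forall>t\<in>{0..L}. v t = c * \<psi> t"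
proof -
  define k where "k t = E t - \<Lambda> * v t powr p" for t
  define G where "G t = integral {0..t} k - B t" for t
  have vint: "(\<lambda>t. \<Lambda> * v t powr p) absolutely_integrable_on {0..L}"
    by (intro absolutely_integrable_continuous_real continuous_on_mult continuous_on_const
        pos_part_powr_continuous)
  have "k absolutely_integrable_on {0..L}"
    unfolding k_def by (intro set_integral_diff(1) pos_energy_absolutely_integrable vint)
  then have k: "primitive_on 0 L (\<lambda>t. integral {0..t} k) k"
    by (rule primitive_on_integral)
  have cG: "continuous_on {0..L} G"
    unfolding G_def
    by (intro continuous_on_diff primitive_on_continuous[OF k] continuous_on_calibration)
  have Gst: "primitive_on s t G (\<lambda>t. k t - B' t)" if "0 < s" "t < L" for s t
    unfolding G_def using that
    by (intro primitive_on_diff primitive_on_calibration primitive_on_subinterval[OF k]) auto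
  have kB: "k t - B' t \<ge> 0" if "t \<in> {0<..<L}" for t
    using calibration_inequality(1)[OF that] unfolding k_def by linarith
  have mono: "G s \<le> G t" if "0 < s" "s \<le> t" "t < L" for s t
  proof -
    have "0 \<le> G t - G s"
      by (rule has_integral_nonneg[OF primitive_on_has_integral[OF Gst[OF that(1,3)]]])
        (use that kB in auto)
    then show ?thesis by simp
  qed
  have lim0: "(G \<longlongrightarrow> G 0) (at_right 0)" and limL: "(G \<longlongrightarrow> G L) (at_left L)"
    using cG L by (auto simp: continuous_on_Icc_at_rightD continuous_on_Icc_at_leftD)
  have lo: "G 0 \<le> G t" if t: "t \<in> {0<..<L}" for t
  proof (rule tendsto_upperbound[OF lim0])
    show "eventually (\<lambda>s. G s \<le> G t) (at_right 0)"
      unfolding eventually_at_right_field using t mono by (intro exI[of _ t]) auto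
  qed auto
  have hi: "G t \<le> G L" if t: "t \<in> {0<..<L}" for t
  proof (rule tendsto_lowerbound[OF limL])
    show "eventually (\<lambda>s. G t \<le> G s) (at_left L)"
      unfolding eventually_at_left_field using t mono by (intro exI[of _ t]) auto
  qed auto
  have G0: "G 0 = 0" using calibration_0 by (simp add: G_def)
  have "integral {0..L} k = integral {0..L} E - integral {0..L} (\<lambda>t. \<Lambda> * v t powr p)"
    unfolding k_def using pos_energy_absolutely_integrable vint
    by (intro Henstock_Kurzweil_Integration.integral_diff)
      (auto simp: set_lebesgue_integral_eq_integral(1))
  then have GL: "G L = integral {0..L} E - \<Lambda> * integral {0..L} (\<lambda>t. v t powr p)"
    using calibration_0 by (simp add: G_def)
  show "\<Lambda> * integral {0..L} (\<lambda>t. v t powr p) \<le> integral {0..L} E"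
    using lo[of "L/2"] hi[of "L/2"] L G0 GL by simp
  show "\<exists>c\<ge>0. \<forall>t\<in>{0..L}. v t = c * \<psi> t"
    if eq: "\<Lambda> * integral {0..L} (\<lambda>t. v t powr p) = integral {0..L} E"
  proof -
    have "G L = 0" using eq GL by simp
    then have Gz: "G t = 0" if "t \<in> {0<..<L}" for t using lo[OF that] hi[OF that] G0 by simp
    have const: "v t powr p * \<psi> t powr (- p) = v s powr p * \<psi> s powr (- p)"
      if st: "0 < s" "s \<le> t" "t < L" for s t
    proof -
      \<comment> \<open>The derivative of (v / \<psi>)^p; the power p is taken because v^p is a C^1
        function of u. It vanishes where u > 0 by the equality case of Picone's inequality, and
        elsewhere because v is 0.\<close>
      let ?D = "\<lambda>t. p * v t powr (p - 1) * g t * \<psi> t powr (- p) + v t powr p * (- p * \<psi> t powr (- p - 1) * \<psi>' t)"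
      have "negligible {x \<in> {s..t}. k x - B' x \<noteq> 0}"
        using primitive_on_has_integral[OF Gst[OF st(1,3)], of s t] Gz[of s] Gz[of t] st kB
          primitive_on_absolutely_integrable[OF Gst[OF st(1,3)], of s t]
        by (intro has_integral_0_nonneg_imp_negligible) auto
      moreover have "?D x = 0" if "x \<in> {s..t} - {x \<in> {s..t}. k x - B' x \<noteq> 0}" for x
      proof (cases "u x > 0")
        case True
        have x: "x \<in> {0<..<L}" using that st by auto
        have pos: "\<psi> x > 0" using ab_arch_pos[OF p a b L] x by simp
        have gx: "g x = u x * \<psi>' x / \<psi> x"
          by (rule calibration_inequality(2)[OF x _ True]) (use that in \<open>auto simp: k_def\<close>)
        have "u x powr p = u x * u x powr (p - 1)" "\<psi> x powr (- p - 1) = \<psi> x powr (- p) / \<psi> x"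
          using True pos powr_mult_base[of "u x" "p - 1"] by (simp_all add: powr_diff)
        then show ?thesis unfolding gx using True by simp
      qed auto
      ultimately have Dz: "(?D has_integral 0) {s..t}"
        by (rule has_integral_spike[OF _ _ has_integral_0])
      have Dp: "primitive_on s t (\<lambda>t. v t powr p * \<psi> t powr (- p)) ?D"
      proof (rule primitive_on_mult)
        have sub: "{s..t} \<subseteq> {0..L}" "{s..t} \<subseteq> {0<..<L}" using st by auto
        have nz: "\<psi> x \<noteq> 0" "\<psi> x > 0" if "x \<in> {s..t}" for x
          using ab_arch_pos[OF p a b L, of x] that sub by force+
        show "primitive_on s t (\<lambda>t. v t powr p) (\<lambda>t. p * v t powr (p - 1) * g t)"
          using primitive_on_subinterval[OF u] st
          by (intro primitive_on_pos_part_powr p) auto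
        show "primitive_on s t (\<lambda>t. \<psi> t powr (- p)) (\<lambda>t. - p * \<psi> t powr (- p - 1) * \<psi>' t)"
        proof (rule primitive_on_C1[of "{}"])
          have c: "continuous_on {s..t} \<psi>" "continuous_on {s..t} \<psi>'"
            using continuous_on_subset[OF primitive_on_continuous[OF primitive_on_ab_arch[OF p a b L]] sub(1)]
              continuous_on_subset[OF continuous_on_ab_arch_deriv[OF p a b L] sub(1)] by auto
          show "continuous_on {s..t} (\<lambda>t. \<psi> t powr (- p))"
            "continuous_on {s..t} (\<lambda>t. - p * \<psi> t powr (- p - 1) * \<psi>' t)"
            using nz by (intro continuous_on_mult continuous_on_powr continuous_on_const c ballI; blast)+
          show "((\<lambda>t. \<psi> t powr (- p)) has_real_derivative - p * \<psi> x powr (- p - 1) * \<psi>' x) (at x)"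
            if "x \<in> {s<..<t} - {}" for x
            by (rule derivative_eq_intros ab_arch_has_real_derivative[OF p a b L] refl | use nz[of x] that st in simp)+
        qed auto
      qed
      from has_integral_unique[OF primitive_on_has_integral[OF Dp order_refl st(2) order_refl] Dz]
      show ?thesis by simp
    qed
    define c where "c = v (L/2) / \<psi> (L/2)"
    have inner: "v t = c * \<psi> t" if t: "t \<in> {0<..<L}" for t
    proof -
      have half: "L/2 \<in> {0<..<L}" using L by simp
      have pos: "\<psi> t > 0" "\<psi> (L/2) > 0" using ab_arch_pos[OF p a b L] t half by auto
      have "v t powr p * \<psi> t powr (- p) = v (L/2) powr p * \<psi> (L/2) powr (- p)"
        using const[of t "L/2"] const[of "L/2" t] t half by (cases "t \<le> L/2") auto
      then have vp: "(v t / \<psi> t) powr p = (v (L/2) / \<psi> (L/2)) powr p"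
        using pos by (simp add: powr_divide powr_minus divide_simps)
      have "v t / \<psi> t = c"
        unfolding c_def using pos p by (intro powr_base_inject[OF _ _ _ vp]) auto
      then show ?thesis using pos by auto
    qed
    have "v t = c * \<psi> t" if t: "t \<in> {0..L}" for t
    proof (cases "t = 0 \<or> t = L")
      case True
      then show ?thesis using u0 uL p a b L by auto
    next
      case False
      then show ?thesis using t by (intro inner) auto
    qed
    moreover have "c \<ge> 0" using ab_arch_pos[OF p a b L, of "L/2"] L by (simp add: c_def)
    ultimately show ?thesis by blast
  qed
qed

end

section \<open>Minimisers and eigenfunctions\<close>

lemma LBINT_eq_integral:
  fixes f :: "real \<Rightarrow> real"
  assumes "f absolutely_integrable_on {a..b}" "f \<in> borel_measurable borel"
  shows "(LBINT t:{a..b}. f t) = integral {a..b} f"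
  using assms by (intro set_borel_integral_eq_integral)
    (simp add: set_integrable_lborel_iff_absolutely_integrable)

text \<open>Only the values of \<open>f\<close> on \<open>{a..b}\<close> are known: the functions
  \<open>u\<close> of the statement are arbitrary outside the interval and may fail to be measurable
  there.\<close>

lemma LBINT_eq_integral_continuous:
  fixes f h :: "real \<Rightarrow> real"
  assumes "continuous_on {a..b} h" "\<And>t. t \<in> {a..b} \<Longrightarrow> f t = h t"
  shows "(LBINT t:{a..b}. f t) = integral {a..b} h"
proof -
  have "(LBINT t:{a..b}. f t) = (LBINT t:{a..b}. h t)"
    using assms(2) by (intro set_lebesgue_integral_cong) auto
  then show ?thesis
    using assms(1) by (simp add: borel_integrable_atLeastAtMost' set_borel_integral_eq_integral)
qed

lemma W1p0_derivD:
  assumes "W1p0_deriv p L u g" "L > 0"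
  shows "primitive_on 0 L u g" "u 0 = 0" "u L = 0" "g \<in> borel_measurable borel"
    "(\<lambda>t. \<bar>g t\<bar> powr p) absolutely_integrable_on {0..L}"
proof -
  have g: "g \<in> borel_measurable borel" "set_integrable lborel {0..L} g"
    "set_integrable lborel {0..L} (\<lambda>t. \<bar>g t\<bar> powr p)"
    and u: "\<And>t. t \<in> {0..L} \<Longrightarrow> u t = (LBINT s:{0..t}. g s)" "u L = 0"
    using assms by (auto simp: W1p0_deriv_def)
  show "u L = 0" "g \<in> borel_measurable borel" using u g by auto
  have ga: "g absolutely_integrable_on {0..L}"
    using g by (simp add: set_integrable_lborel_iff_absolutely_integrable)
  show "(\<lambda>t. \<bar>g t\<bar> powr p) absolutely_integrable_on {0..L}"
    using g(1,3) by (subst set_integrable_lborel_iff_absolutely_integrable[symmetric]) auto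
  have eq: "u t = integral {0..t} g" if "t \<in> {0..L}" for t
    using that u(1)[OF that] LBINT_eq_integral[OF absolutely_integrable_on_subinterval[OF ga] g(1), of 0 t]
    by auto
  show "primitive_on 0 L u g"
    by (rule primitive_on_cong[OF primitive_on_integral[OF ga]]) (simp_all add: eq)
  show "u 0 = 0" using eq[of 0] assms by simp
qed

text \<open>The derivative is cut off outside \<open>[0, L]\<close> since it has to be Borel on the whole line.\<close>
lemma W1p0_derivI:
  assumes "primitive_on 0 L u g" "u 0 = 0" "u L = 0" "continuous_on {0..L} g" "p > 1"
  shows "W1p0_deriv p L u (\<lambda>t. indicator {0..L} t * g t)"
proof -
  let ?g = "\<lambda>t. indicator {0..L} t * g t"
  have meas: "?g \<in> borel_measurable borel"
    using borel_measurable_continuous_on_indicator[OF _ assms(4)] by simp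
  have ga: "g absolutely_integrable_on {0..L}" using assms by (simp add: primitive_on_def)
  then have 1: "?g absolutely_integrable_on {0..L}"
    by (rule absolutely_integrable_spike[of _ _ "{}"]) auto
  have "continuous_on {0..L} (\<lambda>t. \<bar>g t\<bar> powr p)"
    using assms by (intro continuous_on_powr' continuous_intros) auto
  then have 2: "(\<lambda>t. \<bar>?g t\<bar> powr p) absolutely_integrable_on {0..L}"
    by (rule absolutely_integrable_spike[OF absolutely_integrable_continuous_real, of _ _ _ "{}"]) auto
  have "u t = (LBINT s:{0..t}. ?g s)" if t: "t \<in> {0..L}" for t
  proof -
    have "(LBINT s:{0..t}. ?g s) = integral {0..t} ?g"
      using t by (intro LBINT_eq_integral absolutely_integrable_on_subinterval[OF 1] meas) auto
    also have "\<dots> = integral {0..t} g"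
      using t by (intro integral_cong) auto
    also have "\<dots> = u t"
      using primitive_on_has_integral[OF assms(1), of 0 t] t assms(2) by (simp add: integral_unique)
    finally show ?thesis by simp
  qed
  then show ?thesis
    unfolding W1p0_deriv_def using meas 1 2 assms(3)
    by (simp add: set_integrable_lborel_iff_absolutely_integrable)
qed

lemma W1p0_deriv_uminus:
  assumes "W1p0_deriv p L u g"
  shows "W1p0_deriv p L (\<lambda>t. - u t) (\<lambda>t. - g t)"
  using assms by (auto simp: W1p0_deriv_def set_integrable_def set_lebesgue_integral_def)

lemma ab_eigenvalue_commute: "ab_eigenvalue p a b L = ab_eigenvalue p b a L"
  by (simp add: ab_eigenvalue_def ab_freq_def add.commute)

lemma ab_eigenvalue_eq:
  assumes "p > 1" "a > 0" "b > 0" "L > 0"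
  shows "ab_eigenvalue p a b L = ((a + b) / 2) powr p * lambda_kp 1 p L"
proof -
  have "ab_freq p a b L powr p = ((a + b) / 2 * (pi_p p / L)) powr p" by (simp add: ab_freq_def)
  also have "\<dots> = ((a + b) / 2) powr p * (pi_p p / L) powr p"
    by (rule powr_mult)
  finally show ?thesis by (simp add: ab_eigenvalue_def lambda_kp_def)
qed

lemma borel_measurable_ab_flux [measurable]: "ab_flux p a b \<in> borel_measurable borel"
  unfolding ab_flux_def[abs_def] by measurable

lemma weak_sol_ab_altdef:
  "weak_sol_ab p a b L lam u \<longleftrightarrow>
     (\<exists>g. W1p0_deriv p L u g \<and> (\<forall>v h. W1p0_deriv p L v h \<longrightarrow>
        (LBINT t:{0..L}. ab_flux p a b (g t) * h t)
           = lam * (LBINT t:{0..L}. sgn (u t) * \<bar>u t\<bar> powr (p - 1) * v t)))"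
  by (simp add: weak_sol_ab_def ab_flux_def)

lemma sgn_mult_powr_mult_self:
  fixes x p :: real
  assumes "p > 1"
  shows "sgn x * \<bar>x\<bar> powr (p - 1) * x = \<bar>x\<bar> powr p"
proof -
  have "sgn x * \<bar>x\<bar> powr (p - 1) * x = \<bar>x\<bar> * \<bar>x\<bar> powr (p - 1)"
    by (metis abs_sgn mult.assoc mult.commute)
  then show ?thesis by (simp add: powr_mult_base)
qed

text \<open>Under reflection the positive and the negative part of the derivative trade places, and
  with them \<open>a\<close> and \<open>b\<close>.\<close>

lemma weak_sol_ab_uminus:
  assumes "weak_sol_ab p b a L lam (\<lambda>t. - u t)"
  shows "weak_sol_ab p a b L lam u"
proof -
  obtain g where g: "W1p0_deriv p L (\<lambda>t. - u t) g"
    and w: "\<And>v h. W1p0_deriv p L v h \<Longrightarrow> (LBINT t:{0..L}. ab_flux p b a (g t) * h t)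
           = lam * (LBINT t:{0..L}. sgn (- u t) * \<bar>- u t\<bar> powr (p - 1) * v t)"
    using assms unfolding weak_sol_ab_altdef by blast
  have "W1p0_deriv p L u (\<lambda>t. - g t)" using W1p0_deriv_uminus[OF g] by simp
  moreover have "(LBINT t:{0..L}. ab_flux p a b (- g t) * h t)
      = lam * (LBINT t:{0..L}. sgn (u t) * \<bar>u t\<bar> powr (p - 1) * v t)" if "W1p0_deriv p L v h" for v h
    using w[OF that] by (simp add: ab_flux_uminus sgn_minus set_lebesgue_integral_def)
  ultimately show ?thesis unfolding weak_sol_ab_altdef by blast
qed

section \<open>Variational characterisation of the first eigenvalue\<close>

context
  fixes p a b L :: real
  assumes p: "p > 1" and a: "a > 0" and b: "b > 0" and L: "L > 0"
begin

text \<open>The arches for (a,b) and for (b,a) have the same eigenvalue, so the bounds for u and -u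
  add up. In the case of equality both parts of u are multiples of strictly positive arches. If the
  multiple c for the positive part is not 0, then u > 0 throughout (0,L); otherwise u is minus its
  negative part.\<close>

lemma ab_energy_minimum:
  assumes W: "W1p0_deriv p L u g"
  defines "N \<equiv> LBINT t:{0..L}. \<bar>u t\<bar> powr p" and "E \<equiv> LBINT t:{0..L}. ab_energy p a b (g t)"
  shows "ab_eigenvalue p a b L * N \<le> E"
    and "ab_eigenvalue p a b L * N = E \<Longrightarrow>
      \<exists>c\<ge>0. (\<forall>t\<in>{0..L}. u t = c * ab_arch p a b L t) \<or> (\<forall>t\<in>{0..L}. u t = - (c * ab_arch p b a L t))"
proof -
  let ?\<Lambda> = "ab_eigenvalue p a b L"
  note u = W1p0_derivD[OF W L]
  note u' = W1p0_derivD[OF W1p0_deriv_uminus[OF W] L]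
  note A = p a b L u(1-3,5)
  note A' = p b a L u'(1-3,5)
  define Ip where "Ip = integral {0..L} (\<lambda>t. max (u t) 0 powr p)"
  define Im where "Im = integral {0..L} (\<lambda>t. max (- u t) 0 powr p)"
  define Ep where "Ep = integral {0..L} (\<lambda>t. if u t > 0 then ab_energy p a b (g t) else 0)"
  define Em where "Em = integral {0..L} (\<lambda>t. if - u t > 0 then ab_energy p b a (- g t) else 0)"
  have ge: "?\<Lambda> * Ip \<le> Ep" "?\<Lambda> * Im \<le> Em"
    unfolding Ip_def Im_def Ep_def Em_def
    using pos_part_energy_ge[OF A] pos_part_energy_ge[OF A']
    by (simp_all add: ab_eigenvalue_commute[of p b a])
  have N: "N = Ip + Im"
  proof -
    have cu: "continuous_on {0..L} (\<lambda>t. \<bar>u t\<bar> powr p)"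
      using p primitive_on_continuous[OF u(1)]
      by (intro continuous_on_powr' continuous_intros) auto
    have i: "(\<lambda>t. max (u t) 0 powr p) integrable_on {0..L}" "(\<lambda>t. max (- u t) 0 powr p) integrable_on {0..L}"
      using pos_part_powr_continuous[OF A] pos_part_powr_continuous[OF A']
      by (auto intro: integrable_continuous_interval)
    have "N = integral {0..L} (\<lambda>t. \<bar>u t\<bar> powr p)"
      unfolding N_def by (rule LBINT_eq_integral_continuous[OF cu]) simp
    also have "\<dots> = integral {0..L} (\<lambda>t. max (u t) 0 powr p + max (- u t) 0 powr p)"
      using p by (intro integral_cong) (auto simp: max_def)
    also have "\<dots> = Ip + Im"
      unfolding Ip_def Im_def by (rule Henstock_Kurzweil_Integration.integral_add[OF i])
    finally show ?thesis .
  qed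
  \<comment> \<open>The energy on the set u = 0 is dropped; it is nonnegative.\<close>
  have E: "Ep + Em \<le> E"
  proof -
    note i = pos_energy_absolutely_integrable[OF A] pos_energy_absolutely_integrable[OF A']
      ab_energy_absolutely_integrable[OF A]
    note i' = i[THEN set_lebesgue_integral_eq_integral(1)]
    have "Ep + Em = integral {0..L} (\<lambda>t. (if u t > 0 then ab_energy p a b (g t) else 0)
        + (if - u t > 0 then ab_energy p b a (- g t) else 0))"
      unfolding Ep_def Em_def by (rule Henstock_Kurzweil_Integration.integral_add[OF i'(1,2), symmetric])
    also have "\<dots> \<le> integral {0..L} (\<lambda>t. ab_energy p a b (g t))"
      using integrable_add[OF i'(1,2)] i'(3)
      by (rule integral_le) (auto simp: ab_energy_uminus ab_energy_nonneg)
    also have "\<dots> = E"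
      unfolding E_def using u(4) by (intro LBINT_eq_integral[symmetric] i(3)) measurable
    finally show ?thesis .
  qed
  show "?\<Lambda> * N \<le> E" unfolding N using ge E by (simp add: algebra_simps)
  show "\<exists>c\<ge>0. (\<forall>t\<in>{0..L}. u t = c * ab_arch p a b L t) \<or> (\<forall>t\<in>{0..L}. u t = - (c * ab_arch p b a L t))"
    if eq: "?\<Lambda> * N = E"
  proof -
    \<comment> \<open>The inequalities in \<open>ge\<close> and \<open>E\<close> add up to the
      assumed equality, so none of them is strict.\<close>
    have "?\<Lambda> * Ip = Ep" "?\<Lambda> * Im = Em"
      using ge E eq unfolding N by (simp_all add: algebra_simps)
    then obtain c d where c: "c \<ge> 0" "\<And>t. t \<in> {0..L} \<Longrightarrow> max (u t) 0 = c * ab_arch p a b L t"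
      and d: "d \<ge> 0" "\<And>t. t \<in> {0..L} \<Longrightarrow> max (- u t) 0 = d * ab_arch p b a L t"
      using pos_part_energy_eq[OF A] pos_part_energy_eq[OF A']
      unfolding Ip_def Im_def Ep_def Em_def by (auto simp: ab_eigenvalue_commute[of p b a])
    show ?thesis
    proof (cases "c = 0")
      case True
      have "u t = - (d * ab_arch p b a L t)" if "t \<in> {0..L}" for t
        using c(2)[OF that] d(2)[OF that] True by (auto simp: max_def split: if_splits)
      then show ?thesis using d by blast
    next
      case False
      have inner: "u t = c * ab_arch p a b L t" if "t \<in> {0<..<L}" for t
      proof -
        have "0 < c * ab_arch p a b L t"
          using ab_arch_pos[OF p a b L that] False c(1) by simp
        then show ?thesis using c(2)[of t] that by (auto simp: max_def split: if_splits)
      qed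
      have "u t = c * ab_arch p a b L t" if t: "t \<in> {0..L}" for t
      proof (cases "t = 0 \<or> t = L")
        case True
        then show ?thesis using u(2,3) p a b L by auto
      next
        case False
        then show ?thesis using t by (intro inner) auto
      qed
      then show ?thesis using c(1) by blast
    qed
  qed
qed

lemma weak_sol_ab_energy:
  assumes "weak_sol_ab p a b L lam u"
  obtains g where "W1p0_deriv p L u g"
    "(LBINT t:{0..L}. ab_energy p a b (g t)) = lam * (LBINT t:{0..L}. \<bar>u t\<bar> powr p)"
proof -
  obtain g where W: "W1p0_deriv p L u g" and w: "\<And>v h. W1p0_deriv p L v h \<Longrightarrow>
      (LBINT t:{0..L}. ab_flux p a b (g t) * h t)
        = lam * (LBINT t:{0..L}. sgn (u t) * \<bar>u t\<bar> powr (p - 1) * v t)"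
    using assms unfolding weak_sol_ab_altdef by blast
  from w[OF W] have "(LBINT t:{0..L}. ab_energy p a b (g t)) = lam * (LBINT t:{0..L}. \<bar>u t\<bar> powr p)"
    unfolding ab_flux_times_self[OF p] sgn_mult_powr_mult_self[OF p] .
  then show ?thesis using that W by blast
qed

text \<open>Integration by parts against the flux of the arch, without boundary terms since test
  functions vanish at both ends. Both sides are homogeneous of degree p - 1 under positive factors,
  so c enters as \<open>c powr (p - 1)\<close> on either side.\<close>

lemma weak_sol_ab_arch:
  assumes c: "c > 0" and u: "\<And>t. t \<in> {0..L} \<Longrightarrow> u t = c * ab_arch p a b L t"
  shows "weak_sol_ab p a b L (ab_eigenvalue p a b L) u"
proof -
  let ?\<Lambda> = "ab_eigenvalue p a b L" and ?\<psi> = "ab_arch p a b L" and ?d = "ab_arch_deriv p a b L"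
  define g where "g = (\<lambda>t. indicator {0..L} t * (c * ?d t))"
  have "primitive_on 0 L u (\<lambda>t. c * ?d t)"
    by (rule primitive_on_cong[OF primitive_on_cmult[OF primitive_on_ab_arch[OF p a b L], of c]])
      (simp_all add: u)
  then have W: "W1p0_deriv p L u g"
    unfolding g_def using u[of 0] u[of L] L a b p
    by (intro W1p0_derivI continuous_on_mult continuous_on_const continuous_on_ab_arch_deriv) auto
  have "(LBINT t:{0..L}. ab_flux p a b (g t) * h t)
           = ?\<Lambda> * (LBINT t:{0..L}. sgn (u t) * \<bar>u t\<bar> powr (p - 1) * v t)"
    if "W1p0_deriv p L v h" for v h
  proof -
    note v = W1p0_derivD[OF that L]
    let ?q = "\<lambda>t. ab_flux p a b (?d t)"
    define k where "k = c powr (p - 1)"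
    have cq: "continuous_on {0..L} ?q"
      by (rule primitive_on_continuous[OF primitive_on_ab_flux[OF p a b L]])
    have c\<psi>: "continuous_on {0..L} (\<lambda>t. ?\<psi> t powr (p - 1) * v t)"
      using p ab_arch_range[OF p a b L] primitive_on_continuous[OF primitive_on_ab_arch[OF p a b L]]
      by (intro continuous_on_mult primitive_on_continuous[OF v(1)] continuous_on_powr'
          continuous_on_const) auto
    have qh: "(\<lambda>t. ?q t * h t) absolutely_integrable_on {0..L}"
      using v(1) by (intro absolutely_integrable_continuous_mult cq) (simp add: primitive_on_def)
    have prod: "primitive_on 0 L (\<lambda>t. ?q t * v t) (\<lambda>t. - ?\<Lambda> * ?\<psi> t powr (p - 1) * v t + ?q t * h t)"
      by (rule primitive_on_mult[OF primitive_on_ab_flux[OF p a b L] v(1)])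
    have sum0: "((\<lambda>t. - ?\<Lambda> * (?\<psi> t powr (p - 1) * v t) + ?q t * h t) has_integral 0) {0..L}"
      using primitive_on_has_integral[OF prod, of 0 L] v(2,3) L by (simp add: mult.assoc)
    have "((\<lambda>t. - ?\<Lambda> * (?\<psi> t powr (p - 1) * v t) + ?q t * h t) has_integral
        - ?\<Lambda> * integral {0..L} (\<lambda>t. ?\<psi> t powr (p - 1) * v t) + integral {0..L} (\<lambda>t. ?q t * h t)) {0..L}"
      using qh[THEN set_lebesgue_integral_eq_integral(1)] integrable_continuous_interval[OF c\<psi>]
      by (intro has_integral_add has_integral_mult_right integrable_integral)
    from has_integral_unique[OF this sum0] have parts: "integral {0..L} (\<lambda>t. ?q t * h t) =
        ?\<Lambda> * integral {0..L} (\<lambda>t. ?\<psi> t powr (p - 1) * v t)"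
      by simp
    have gq: "ab_flux p a b (g t) * h t = k * (?q t * h t)" if "t \<in> {0..L}" for t
      using that c by (simp add: g_def k_def ab_flux_mult_pos)
    have [measurable]: "g \<in> borel_measurable borel" "h \<in> borel_measurable borel"
      using W1p0_derivD(4)[OF W L] v(4) by auto
    have "(\<lambda>t. k * (?q t * h t)) absolutely_integrable_on {0..L}"
      using qh by auto
    then have "(\<lambda>t. ab_flux p a b (g t) * h t) absolutely_integrable_on {0..L}"
      by (rule absolutely_integrable_spike[of _ _ "{}"]) (simp_all add: gq)
    then have "(LBINT t:{0..L}. ab_flux p a b (g t) * h t) = integral {0..L} (\<lambda>t. ab_flux p a b (g t) * h t)"
      by (rule LBINT_eq_integral) measurable
    also have "\<dots> = k * integral {0..L} (\<lambda>t. ?q t * h t)"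
      using integral_cong[of "{0..L}", OF gq] by simp
    also have "\<dots> = ?\<Lambda> * integral {0..L} (\<lambda>t. k * (?\<psi> t powr (p - 1) * v t))"
      unfolding parts by simp
    also have "integral {0..L} (\<lambda>t. k * (?\<psi> t powr (p - 1) * v t)) =
        (LBINT t:{0..L}. sgn (u t) * \<bar>u t\<bar> powr (p - 1) * v t)"
    proof (rule LBINT_eq_integral_continuous[symmetric])
      show "continuous_on {0..L} (\<lambda>t. k * (?\<psi> t powr (p - 1) * v t))"
        by (intro continuous_on_mult[OF continuous_on_const c\<psi>])
      show "sgn (u t) * \<bar>u t\<bar> powr (p - 1) * v t = k * (?\<psi> t powr (p - 1) * v t)" if t: "t \<in> {0..L}" for t
      proof (cases "?\<psi> t = 0")
        case False
        then have "?\<psi> t > 0" using ab_arch_range[OF p a b L t] by simp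
        then show ?thesis using c u[OF t] by (simp add: k_def powr_mult)
      qed (use u[OF t] in simp)
    qed
    finally show ?thesis .
  qed
  with W show ?thesis unfolding weak_sol_ab_altdef by blast
qed

text \<open>The integral scales like c^p. The equivalence is used in both directions: to exhibit a
  normalised minimiser and to identify the normalised function \<open>phi_p\<close>.\<close>

lemma ab_arch_normalized:
  obtains \<kappa> where "\<kappa> > 0"
    "\<And>u c. (\<And>t. t \<in> {0..L} \<Longrightarrow> u t = c * ab_arch p a b L t) \<Longrightarrow> c > 0 \<Longrightarrow>
       (LBINT t:{0..L}. \<bar>u t\<bar> powr p) = 1 \<longleftrightarrow> c = \<kappa>"
proof -
  let ?\<psi> = "ab_arch p a b L"
  define I where "I = integral {0..L} (\<lambda>t. ?\<psi> t powr p)"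
  have cont: "continuous_on {0..L} (\<lambda>t. ?\<psi> t powr p)"
    using p ab_arch_range[OF p a b L] primitive_on_continuous[OF primitive_on_ab_arch[OF p a b L]]
    by (intro continuous_on_powr' continuous_on_const) auto
  have "I \<noteq> 0"
  proof
    assume "I = 0"
    then have "(\<lambda>t. ?\<psi> t powr p) (L/2) = 0"
      using L integrable_integral[OF integrable_continuous_interval[OF cont]]
      by (intro has_integral_0_cbox_imp_0[of 0 L "\<lambda>t. ?\<psi> t powr p"] cont) (auto simp: I_def cont)
    then show False using ab_arch_pos[OF p a b L, of "L/2"] L by simp
  qed
  moreover have "I \<ge> 0" unfolding I_def by (rule integral_nonneg[OF integrable_continuous_interval[OF cont]]) simp
  ultimately have I: "I > 0" by simp
  have norm: "(LBINT t:{0..L}. \<bar>u t\<bar> powr p) = c powr p * I"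
    if u: "\<And>t. t \<in> {0..L} \<Longrightarrow> u t = c * ?\<psi> t" and c: "c > 0" for u c
  proof -
    have "(LBINT t:{0..L}. \<bar>u t\<bar> powr p) = integral {0..L} (\<lambda>t. c powr p * ?\<psi> t powr p)"
    proof (rule LBINT_eq_integral_continuous)
      show "continuous_on {0..L} (\<lambda>t. c powr p * ?\<psi> t powr p)"
        by (intro continuous_on_mult continuous_on_const cont)
      show "\<bar>u t\<bar> powr p = c powr p * ?\<psi> t powr p" if "t \<in> {0..L}" for t
        using u[OF that] c ab_arch_range[OF p a b L that] by (simp add: powr_mult abs_mult)
    qed
    then show ?thesis by (simp add: I_def)
  qed
  define \<kappa> where "\<kappa> = I powr (- 1 / p)"
  have \<kappa>: "\<kappa> > 0" "\<kappa> powr p * I = 1"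
    using I p unfolding \<kappa>_def powr_powr by (simp_all add: powr_minus)
  show ?thesis
  proof (rule that)
    show "\<kappa> > 0" by fact
    show "(LBINT t:{0..L}. \<bar>u t\<bar> powr p) = 1 \<longleftrightarrow> c = \<kappa>"
      if u: "\<And>t. t \<in> {0..L} \<Longrightarrow> u t = c * ?\<psi> t" and c: "c > 0" for u c
    proof
      assume "(LBINT t:{0..L}. \<bar>u t\<bar> powr p) = 1"
      then have "c powr p * I = \<kappa> powr p * I" using norm[OF u c] \<kappa>(2) by simp
      then have "c powr p = \<kappa> powr p" using I by simp
      then show "c = \<kappa>" using powr_base_inject[of p c \<kappa>] c \<kappa>(1) p by simp
    qed (use norm[OF u c] \<kappa> in simp)
  qed
qed

text \<open>The infimum is attained at the normalised arch, whose energy is read off from its own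
  weak equation tested with itself.\<close>

lemma lambda_ab_eq: "lambda_ab p a b L = ab_eigenvalue p a b L"
proof -
  define X where "X = {(LBINT t:{0..L}. ab_energy p a b (g t))
       | u g. W1p0_deriv p L u g \<and> (LBINT t:{0..L}. \<bar>u t\<bar> powr p) = 1}"
  obtain \<kappa> where \<kappa>: "\<kappa> > 0" "\<And>u c. (\<And>t. t \<in> {0..L} \<Longrightarrow> u t = c * ab_arch p a b L t) \<Longrightarrow> c > 0 \<Longrightarrow>
       (LBINT t:{0..L}. \<bar>u t\<bar> powr p) = 1 \<longleftrightarrow> c = \<kappa>"
    using ab_arch_normalized by metis
  define u where "u t = \<kappa> * ab_arch p a b L t" for t
  have n: "(LBINT t:{0..L}. \<bar>u t\<bar> powr p) = 1" using \<kappa>(2)[of u \<kappa>] \<kappa>(1) by (simp add: u_def)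
  obtain g where "W1p0_deriv p L u g"
    "(LBINT t:{0..L}. ab_energy p a b (g t)) = ab_eigenvalue p a b L * (LBINT t:{0..L}. \<bar>u t\<bar> powr p)"
    using weak_sol_ab_energy[OF weak_sol_ab_arch[OF \<kappa>(1), of u]] by (auto simp: u_def)
  then have "ab_eigenvalue p a b L \<in> X" unfolding X_def using n by force
  moreover have "ab_eigenvalue p a b L \<le> x" if "x \<in> X" for x
    using that ab_energy_minimum(1) unfolding X_def by force
  ultimately have "Inf X = ab_eigenvalue p a b L" by (rule cInf_eq_minimum)
  then show ?thesis by (simp add: X_def lambda_ab_def ab_energy_def)
qed

end

text \<open>The negative solution for (a,b) is minus the positive arch for (b,a), so the second
  half-line is obtained from the first by reflection. Nontriviality excludes c = 0.\<close>

lemma eigenfunction_ab_iff: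
  assumes p: "p > 1" and a: "a > 0" and b: "b > 0" and L: "L > 0"
  shows "eigenfunction_ab p a b L (ab_eigenvalue p a b L) u \<longleftrightarrow>
    (\<exists>c>0. (\<forall>t\<in>{0..L}. u t = c * ab_arch p a b L t) \<or> (\<forall>t\<in>{0..L}. u t = - (c * ab_arch p b a L t)))"
proof
  assume "eigenfunction_ab p a b L (ab_eigenvalue p a b L) u"
  then have w: "weak_sol_ab p a b L (ab_eigenvalue p a b L) u" and nz: "\<exists>t\<in>{0..L}. u t \<noteq> 0"
    by (auto simp: eigenfunction_ab_def)
  obtain g where "W1p0_deriv p L u g"
    "(LBINT t:{0..L}. ab_energy p a b (g t)) = ab_eigenvalue p a b L * (LBINT t:{0..L}. \<bar>u t\<bar> powr p)"
    using weak_sol_ab_energy[OF p a b L w] by blast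
  then obtain c where c: "c \<ge> 0" "(\<forall>t\<in>{0..L}. u t = c * ab_arch p a b L t) \<or>
      (\<forall>t\<in>{0..L}. u t = - (c * ab_arch p b a L t))"
    using ab_energy_minimum(2)[OF p a b L] by metis
  then have "c \<noteq> 0" using nz by force
  then show "\<exists>c>0. (\<forall>t\<in>{0..L}. u t = c * ab_arch p a b L t) \<or> (\<forall>t\<in>{0..L}. u t = - (c * ab_arch p b a L t))"
    using c by (intro exI[of _ c]) auto
next
  assume "\<exists>c>0. (\<forall>t\<in>{0..L}. u t = c * ab_arch p a b L t) \<or> (\<forall>t\<in>{0..L}. u t = - (c * ab_arch p b a L t))"
  then obtain c where c: "c > 0" "(\<forall>t\<in>{0..L}. u t = c * ab_arch p a b L t) \<or>
      (\<forall>t\<in>{0..L}. u t = - (c * ab_arch p b a L t))" by blast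
  have half: "L/2 \<in> {0..L}" "ab_arch p a b L (L/2) > 0" "ab_arch p b a L (L/2) > 0"
    using L ab_arch_pos[OF p a b L, of "L/2"] ab_arch_pos[OF p b a L, of "L/2"] by auto
  from c(2) show "eigenfunction_ab p a b L (ab_eigenvalue p a b L) u"
    unfolding eigenfunction_ab_def
  proof (elim disjE, goal_cases)
    case 1
    then show ?case
      using weak_sol_ab_arch[OF p a b L c(1), of u] half c by (auto intro!: bexI[of _ "L/2"])
  next
    case 2
    have "weak_sol_ab p b a L (ab_eigenvalue p b a L) (\<lambda>t. - u t)"
      using 2 by (intro weak_sol_ab_arch[OF p b a L c(1)]) auto
    then show ?case
      using 2 half c weak_sol_ab_uminus by (auto simp: ab_eigenvalue_commute[of p b a] intro!: bexI[of _ "L/2"])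
  qed
qed

section \<open>Identification of the arches with the functions built from
  \<open>phi_p\<close>\<close>

lemma weak_sol_p_iff_weak_sol_ab: "weak_sol_p p L lam u \<longleftrightarrow> weak_sol_ab p 1 1 L lam u"
proof -
  have "sgn x * \<bar>x\<bar> powr (p - 1) = ab_flux p 1 1 x" for x
    by (cases x "0::real" rule: linorder_cases) (auto simp: ab_flux_def)
  then show ?thesis by (simp add: weak_sol_p_def weak_sol_ab_altdef)
qed

text \<open>A definite description can be evaluated only after uniqueness is known. It follows from
  the classification for a = b = 1: positivity selects the half-line, the norm selects the factor,
  and the cutoff fixes the values outside the interval.\<close>

lemma phi_p_eq:
  assumes p: "p > 1"
  obtains \<kappa> where "\<kappa> > 0" "\<And>t. t \<in> {0..1} \<Longrightarrow> phi_p p t = \<kappa> * ab_arch p 1 1 1 t"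
proof -
  note A = p zero_less_one[where 'a = real] zero_less_one[where 'a = real] zero_less_one[where 'a = real]
  let ?\<psi> = "ab_arch p 1 1 1"
  obtain \<kappa> where \<kappa>: "\<kappa> > 0" "\<And>u c. (\<And>t. t \<in> {0..1} \<Longrightarrow> u t = c * ?\<psi> t) \<Longrightarrow> c > 0 \<Longrightarrow>
       (LBINT t:{0..1}. \<bar>u t\<bar> powr p) = 1 \<longleftrightarrow> c = \<kappa>"
    using ab_arch_normalized[OF A] by metis
  have eig: "lambda_kp 1 p 1 = ab_eigenvalue p 1 1 1"
    using ab_eigenvalue_eq[OF A] by simp
  define f where "f t = (if t \<in> {0..1} then \<kappa> * ?\<psi> t else 0)" for t
  have f: "f t = \<kappa> * ?\<psi> t" if "t \<in> {0..1}" for t using that by (simp add: f_def)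
  have "phi_p p = f"
    unfolding phi_p_def
  proof (rule the_equality)
    show "weak_sol_p p 1 (lambda_kp 1 p 1) f \<and> (\<forall>t\<in>{0<..<1}. f t > 0) \<and>
        (LBINT t:{0..1}. \<bar>f t\<bar> powr p) = 1 \<and> (\<forall>t. t \<notin> {0..1} \<longrightarrow> f t = 0)"
      unfolding weak_sol_p_iff_weak_sol_ab eig
    proof (intro conjI ballI allI impI)
      show "weak_sol_ab p 1 1 1 (ab_eigenvalue p 1 1 1) f" by (rule weak_sol_ab_arch[OF A \<kappa>(1) f])
      show "(LBINT t:{0..1}. \<bar>f t\<bar> powr p) = 1" using \<kappa>(2)[OF f \<kappa>(1)] by simp
    qed (use ab_arch_pos[OF A] \<kappa>(1) in \<open>auto simp: f_def\<close>)
  next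
    fix u assume u: "weak_sol_p p 1 (lambda_kp 1 p 1) u \<and> (\<forall>t\<in>{0<..<1}. u t > 0) \<and>
        (LBINT t:{0..1}. \<bar>u t\<bar> powr p) = 1 \<and> (\<forall>t. t \<notin> {0..1} \<longrightarrow> u t = 0)"
    have pos: "u (1/2) > 0" "?\<psi> (1/2) > 0" using u ab_arch_pos[OF A, of "1/2"] by auto
    have "weak_sol_ab p 1 1 1 (ab_eigenvalue p 1 1 1) u"
      using u unfolding weak_sol_p_iff_weak_sol_ab eig by blast
    then have "eigenfunction_ab p 1 1 1 (ab_eigenvalue p 1 1 1) u"
      unfolding eigenfunction_ab_def using pos by (auto intro!: bexI[of _ "1/2"])
    then obtain c where c: "c > 0" "(\<forall>t\<in>{0..1}. u t = c * ?\<psi> t) \<or> (\<forall>t\<in>{0..1}. u t = - (c * ?\<psi> t))"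
      unfolding eigenfunction_ab_iff[OF A] by blast
    have "u (1/2) \<noteq> - (c * ?\<psi> (1/2))" using pos mult_pos_pos[OF c(1) pos(2)] by linarith
    then have uc: "\<And>t. t \<in> {0..1} \<Longrightarrow> u t = c * ?\<psi> t" using c(2) by force
    have "c = \<kappa>" using \<kappa>(2)[OF uc c(1)] u by blast
    then show "u = f" using uc u by (auto simp: f_def fun_eq_iff)
  qed
  then show ?thesis using that \<kappa>(1) f by metis
qed

text \<open>Exchanging \<open>a\<close> and \<open>b\<close> turns \<open>t0\<close> into
  \<open>1 - t0\<close>.\<close>

lemma phi_ab_minus_eq:
  assumes "a > 0" "b > 0"
  shows "phi_ab_minus p a b t = - phi_ab_plus p b a t"
proof -
  define s where "s = a / (a + b)"
  have s: "b / (b + a) = 1 - s" using assms by (simp add: s_def field_simps)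
  show ?thesis
    unfolding phi_ab_minus_def phi_ab_plus_def Let_def s s_def[symmetric] by (simp add: algebra_simps)
qed

text \<open>The affine maps in \<open>phi_ab_plus\<close> carry the parts to the left and right of
  \<open>t0\<close> to the two halves of the unit interval, where the symmetric arch has speed
  \<open>pi_p p\<close>; the resulting angles agree with those of \<open>ab_arch\<close>.\<close>

lemma phi_ab_plus_eq:
  assumes p: "p > 1" and a: "a > 0" and b: "b > 0" and L: "L > 0" and t: "t \<in> {0..L}"
    and \<kappa>: "\<And>t. t \<in> {0..1} \<Longrightarrow> phi_p p t = \<kappa> * ab_arch p 1 1 1 t"
  shows "phi_ab_plus p a b (t / L) = \<kappa> * ab_arch p a b L t"
proof -
  define t0 where "t0 = a / (a + b)"
  have t0: "0 < t0" "t0 < 1" using a b by (auto simp: t0_def)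
  have t01: "1 - t0 = b / (a + b)" using a b by (simp add: t0_def field_simps)
  have freq: "ab_freq p 1 1 1 = pi_p p" by (simp add: ab_freq_def)
  define s where "s = t / L"
  have le: "s \<le> t0 \<longleftrightarrow> t \<le> a * L / (a + b)"
    using L a b by (simp add: s_def t0_def field_simps)
  have s: "0 \<le> s" "s \<le> 1" using t L by (auto simp: s_def)
  have "phi_ab_plus p a b s = \<kappa> * ab_arch p a b L t"
  proof (cases "s < t0")
    case True
    let ?x = "s / (2 * t0)"
    have x: "0 \<le> ?x" "?x \<le> 1/2" using True t0 s by (auto simp: field_simps)
    have "pi_p p * ?x = ab_freq p a b L * t / a"
      using a b L by (simp add: s_def t0_def ab_freq_def ac_simps)
    then have "ab_arch p 1 1 1 ?x = ab_arch p a b L t"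
      using True le x by (simp add: ab_arch_def freq)
    then show ?thesis using True x \<kappa>[of ?x] by (simp add: phi_ab_plus_def flip: t0_def)
  next
    case False
    let ?x = "(s + 1 - 2 * t0) / (2 * (1 - t0))"
    have x: "1/2 \<le> ?x" "?x \<le> 1" using False t0 s by (auto simp: field_simps)
    have "1 - ?x = (1 - s) / (2 * (1 - t0))"
      using t0 by (simp add: field_simps)
    then have arg: "pi_p p * (1 - ?x) = ab_freq p a b L * (L - t) / b"
      using a b L unfolding t01 by (simp add: s_def ab_freq_def field_simps)
    have "ab_arch p 1 1 1 ?x = ab_arch p a b L t"
    \<comment> \<open>At the peak the branches are assigned differently: \<open>phi_ab_plus\<close>
      takes the right formula at \<open>t0\<close>, \<open>ab_arch\<close> the left one. Both sides
      are 1 there.\<close>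
    proof (cases "s = t0")
      case True
      then have "t = a * L / (a + b)" using L by (simp add: s_def t0_def field_simps)
      then have "ab_arch p a b L t = 1" using ab_arch_eq_1_iff[OF p a b L t] by blast
      moreover have half: "?x = 1/2" using True t0 by (simp add: field_simps)
      ultimately show ?thesis
        unfolding half using ab_arch_eq_1_iff[OF p, of 1 1 1 "1/2"] by simp
    next
      case neq: False
      then have "\<not> t \<le> a * L / (a + b)" using le False by linarith
      moreover have "\<not> ?x \<le> 1/2" using False neq t0 by (simp add: field_simps)
      ultimately show ?thesis using arg by (simp add: ab_arch_def freq)
    qed
    moreover have "?x \<in> {0..1}" unfolding atLeastAtMost_iff using x by linarith
    ultimately show ?thesis
      using False \<kappa>[of ?x] by (simp add: phi_ab_plus_def flip: t0_def)
  qed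
  then show ?thesis by (simp add: s_def)
qed

theorem theorem1:
  fixes p a b L :: real
  assumes "p > 1" and "a > 0" and "b > 0" and "L > 0"
  shows "lambda_ab p a b L = ((a + b) / 2) powr p * lambda_kp 1 p L
    \<and> (\<forall>u. eigenfunction_ab p a b L (lambda_ab p a b L) u \<longleftrightarrow>
           (\<exists>c>0. (\<forall>t\<in>{0..L}. u t = c * phi_ab_plus p a b (t / L))
                 \<or> (\<forall>t\<in>{0..L}. u t = c * phi_ab_minus p a b (t / L))))
    \<and> C1_on {0..1} (phi_ab_plus p a b) \<and> C1_on {0..1} (phi_ab_minus p a b)
    \<and> (\<forall>t\<in>{0<..<1}. phi_ab_plus p a b t > 0)
    \<and> (\<forall>t\<in>{0<..<1}. phi_ab_minus p a b t < 0)
    \<and> ((\<forall>t\<in>{0..1}. phi_ab_plus p a b t = - phi_ab_minus p a b t) \<longleftrightarrow> a = b)"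
proof -
  note A = assms and A' = assms(1,3,2,4)
  obtain \<kappa> where \<kappa>: "\<kappa> > 0" "\<And>t. t \<in> {0..1} \<Longrightarrow> phi_p p t = \<kappa> * ab_arch p 1 1 1 t"
    using phi_p_eq[OF assms(1)] by blast
  have plus: "phi_ab_plus p x y (t / l) = \<kappa> * ab_arch p x y l t"
    if "x > 0" "y > 0" "l > 0" "t \<in> {0..l}" for x y l t
    using phi_ab_plus_eq[OF assms(1) that \<kappa>(2)] .
  have plus1: "phi_ab_plus p x y t = \<kappa> * ab_arch p x y 1 t" if "x > 0" "y > 0" "t \<in> {0..1}" for x y t
    using plus[of x y 1 t] that by simp
  have minus: "phi_ab_minus p a b t = - phi_ab_plus p b a t" for t
    using phi_ab_minus_eq assms by blast
  have eigen: "eigenfunction_ab p a b L (lambda_ab p a b L) u \<longleftrightarrow>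
           (\<exists>c>0. (\<forall>t\<in>{0..L}. u t = c * phi_ab_plus p a b (t / L))
                 \<or> (\<forall>t\<in>{0..L}. u t = c * phi_ab_minus p a b (t / L)))" for u
  proof -
    have "(\<exists>c>0. (\<forall>t\<in>{0..L}. u t = c * phi_ab_plus p a b (t / L))
                 \<or> (\<forall>t\<in>{0..L}. u t = c * phi_ab_minus p a b (t / L))) \<longleftrightarrow>
      (\<exists>c>0. (\<forall>t\<in>{0..L}. u t = (c * \<kappa>) * ab_arch p a b L t)
                 \<or> (\<forall>t\<in>{0..L}. u t = - ((c * \<kappa>) * ab_arch p b a L t)))"
      using assms by (simp add: minus plus mult.assoc)
    \<comment> \<open>The positive factor \<kappa> is absorbed: c * \<kappa> runs through all
      positive numbers as c does.\<close>
    also have "\<dots> \<longleftrightarrow> (\<exists>c>0. (\<forall>t\<in>{0..L}. u t = c * ab_arch p a b L t)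
                 \<or> (\<forall>t\<in>{0..L}. u t = - (c * ab_arch p b a L t)))" (is "(\<exists>c>0. ?P (c * \<kappa>)) \<longleftrightarrow> (\<exists>c>0. ?P c)")
    proof
      assume "\<exists>c>0. ?P (c * \<kappa>)"
      then obtain c where "c > 0" "?P (c * \<kappa>)" by blast
      then show "\<exists>c>0. ?P c" using \<kappa>(1) by (intro exI[of _ "c * \<kappa>"] conjI mult_pos_pos)
    next
      assume "\<exists>c>0. ?P c"
      then obtain c where c: "c > 0" "?P c" by blast
      have "c / \<kappa> * \<kappa> = c" using \<kappa>(1) by simp
      with c(2) have "?P (c / \<kappa> * \<kappa>)" by (simp only:)
      then show "\<exists>c>0. ?P (c * \<kappa>)" using \<kappa>(1) c(1) by (intro exI[of _ "c / \<kappa>"] conjI divide_pos_pos)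
    qed
    finally show ?thesis unfolding lambda_ab_eq[OF A] eigenfunction_ab_iff[OF A] by blast
  qed
  \<comment> \<open>The factor \<open>c\<close> lets one argument serve both functions: 1 for
    \<open>phi_ab_plus p a b\<close>, and -1 with \<open>a\<close> and \<open>b\<close> exchanged
    for \<open>phi_ab_minus p a b\<close>.\<close>
  have C1: "C1_on {0..1} (\<lambda>t. c * phi_ab_plus p x y t)" if xy: "x > 0" "y > 0" for x y c
    unfolding C1_on_def
  proof (intro exI conjI ballI)
    let ?g = "\<lambda>t. (c * \<kappa>) * ab_arch_deriv p x y 1 t"
    show cont: "continuous_on {0..1} ?g"
      using xy assms(1)
      by (intro continuous_on_mult[OF continuous_on_const] continuous_on_ab_arch_deriv) auto
    have "primitive_on 0 1 (\<lambda>t. c * phi_ab_plus p x y t) ?g"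
      by (rule primitive_on_cong[OF primitive_on_cmult[OF primitive_on_ab_arch, of p x y 1 "c * \<kappa>"]])
        (use xy assms(1) in \<open>simp_all add: plus1\<close>)
    then show "((\<lambda>t. c * phi_ab_plus p x y t) has_real_derivative ?g t) (at t within {0..1})"
      if "t \<in> {0..1}" for t
      using primitive_on_has_real_derivative cont that by blast
  qed
  have C1p: "C1_on {0..1} (phi_ab_plus p a b)" and C1m: "C1_on {0..1} (phi_ab_minus p a b)"
    using C1[of a b 1] C1[of b a "-1"] assms by (simp_all add: minus[abs_def])
  have pos: "phi_ab_plus p x y t > 0" if "x > 0" "y > 0" "t \<in> {0<..<1}" for x y t
    using ab_arch_pos[OF assms(1) that(1,2), of 1 t] plus1[of x y t] that \<kappa>(1) by simp
  have sym: "(\<forall>t\<in>{0..1}. phi_ab_plus p a b t = - phi_ab_minus p a b t) \<longleftrightarrow> a = b"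
  proof
    assume eq: "\<forall>t\<in>{0..1}. phi_ab_plus p a b t = - phi_ab_minus p a b t"
    \<comment> \<open>The peak of the arch for (a,b) on the unit interval. The other arch reaches 1
      only at b / (b + a), so equal functions have coinciding peaks.\<close>
    define t where "t = a / (a + b)"
    have t: "t \<in> {0..1}" using assms by (simp add: t_def)
    have "\<kappa> * ab_arch p a b 1 t = \<kappa> * ab_arch p b a 1 t"
      using bspec[OF eq t] t assms by (simp add: minus plus1)
    moreover have "ab_arch p a b 1 t = 1"
      using ab_arch_eq_1_iff[OF assms(1-3) _ t] by (simp add: t_def)
    ultimately have "ab_arch p b a 1 t = 1" using \<kappa>(1) by simp
    then have "t = b / (b + a)"
      using ab_arch_eq_1_iff[OF assms(1,3,2) _ t] by simp
    then show "a = b" using assms unfolding t_def by (simp add: add.commute)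
  next
    assume "a = b"
    then show "\<forall>t\<in>{0..1}. phi_ab_plus p a b t = - phi_ab_minus p a b t"
      unfolding minus by simp
  qed
  show ?thesis
  proof (intro conjI allI ballI)
    show "phi_ab_minus p a b t < 0" if "t \<in> {0<..<1}" for t
      using pos[OF assms(3,2) that] by (simp add: minus)
  qed (use lambda_ab_eq[OF A] ab_eigenvalue_eq[OF A] eigen C1p C1m pos assms sym in auto)
qed

end
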